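(* The algebraic-to-hyperplane multiple reachability problem is undecidable: there is no algorithm which, given $d\in\mathbb{N}$, an algebraic set $S\subseteq\mathbb{R}^d$, a hyperplane $T\subseteq\mathbb{R}^d$, a matrix $M\in\mathbb{Q}^{d\times d}$ and $m\in\mathbb{N}$, decides whether there exists $\vec p\in S$ such that $|\mathcal{O}(\vec p,M)\cap T|\ge m$.
   Context: Let $\mathbb{N}=\{1,2,3,\ldots\}$. For $M\in\mathbb{Q}^{d\times d}$ and $\vec p\in\mathbb{R}^d$ (row vector), the orbit is $\mathcal{O}(\vec p,M)=\{\vec p M^n : n\in\mathbb{N}\}$. An algebraic set is the set of real zeros in $\mathbb{R}^d$ of a polynomial with integer coefficients (given by that polynomial). A hyperplane is a set $\{(x_1,\ldots,x_d)\in\mathbb{R}^d : a_1x_1+\cdots+a_dx_d+a_{d+1}=0\}$ with integers $a_i$. *)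

theory Defs
  imports Complex_Main "HOL-Library.Nat_Bijection" "Jordan_Normal_Form.Matrix"
begin

datatype recf =
    Zero
  | Succ
  | Proj nat
  | Comp recf "recf list"
  | PrimRec recf recf
  | Mu recf

text \<open>
  Algorithms are partial recursive functions on natural numbers;
  \<open>computes f xs y\<close> means that the program \<open>f\<close> halts on the arguments \<open>xs\<close> with output \<open>y\<close>.
  The recursion variable of \<open>PrimRec\<close> and the search variable of \<open>Mu\<close> are the first
  argument. In \<open>Mu\<close> every value below the result has to be defined and positive.
\<close>

inductive computes :: "recf \<Rightarrow> nat list \<Rightarrow> nat \<Rightarrow> bool" where
  Zero: "computes Zero xs 0"
| Succ: "computes Succ [x] (Suc x)"
| Proj: "i < length xs \<Longrightarrow> computes (Proj i) xs (xs ! i)"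
| Comp: "list_all2 (\<lambda>g y. computes g xs y) gs ys \<Longrightarrow> computes f ys z
    \<Longrightarrow> computes (Comp f gs) xs z"
| PrimRec_0: "computes f xs y \<Longrightarrow> computes (PrimRec f g) (0 # xs) y"
| PrimRec_Suc: "computes (PrimRec f g) (n # xs) r \<Longrightarrow> computes g (n # r # xs) y
    \<Longrightarrow> computes (PrimRec f g) (Suc n # xs) y"
| Mu: "computes f (n # xs) 0 \<Longrightarrow> \<forall>i<n. \<exists>y. computes f (i # xs) (Suc y)
    \<Longrightarrow> computes (Mu f) xs n"

lemma computes_deterministic:
  "computes f xs y \<Longrightarrow> computes f xs z \<Longrightarrow> y = z"
proof (induction arbitrary: z rule: computes.induct)
  case (Comp xs gs ys f w)
  from Comp.prems obtain ys' where
    ys': "list_all2 (\<lambda>g y. computes g xs y) gs ys'" and z: "computes f ys' z"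
    by (cases rule: computes.cases) auto
  have "ys = ys'"
  proof (rule nth_equalityI)
    show "length ys = length ys'"
      using Comp.IH(1) ys' by (simp add: list_all2_conv_all_nth)
    show "ys ! i = ys' ! i" if "i < length ys" for i
      using Comp.IH(1) ys' that by (auto simp: list_all2_conv_all_nth)
  qed
  then show ?case using Comp.IH(2) z by simp
next
  case (PrimRec_0 f xs y g)
  from PrimRec_0.prems show ?case
    by (cases rule: computes.cases) (auto intro: PrimRec_0.IH)
next
  case (PrimRec_Suc f g n xs r y)
  from PrimRec_Suc.prems obtain r' where
    "computes (PrimRec f g) (n # xs) r'" "computes g (n # r' # xs) z"
    by (cases rule: computes.cases) auto
  then show ?case using PrimRec_Suc.IH by blast
next
  case (Mu f n xs)
  from Mu.prems have z: "computes f (z # xs) 0"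
    and less: "\<forall>i<z. \<exists>y. computes f (i # xs) (Suc y)"
    by (cases rule: computes.cases; auto)+
  show ?case
  proof (cases n z rule: linorder_cases)
    case less
    then show ?thesis using Mu.IH(1) \<open>\<forall>i<z. _ i\<close> by blast
  next
    case greater
    then show ?thesis using Mu.IH(2) z by blast
  qed
qed (erule computes.cases; simp)+

text \<open>
  A polynomial with integer coefficients in \<open>d\<close> variables is given as a list of terms,
  each consisting of a coefficient and the list of the \<open>d\<close> exponents.
\<close>

type_synonym int_mpoly = "(int \<times> nat list) list"

definition mpoly_in :: "nat \<Rightarrow> int_mpoly \<Rightarrow> bool" where
  "mpoly_in d P \<longleftrightarrow> (\<forall>(c, e) \<in> set P. length e = d)"

definition eval_mpoly :: "int_mpoly \<Rightarrow> real vec \<Rightarrow> real" where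
  "eval_mpoly P x = (\<Sum>(c, e) \<leftarrow> P. of_int c * (\<Prod>i<dim_vec x. x $ i ^ (e ! i)))"

definition algebraic_set :: "nat \<Rightarrow> int_mpoly \<Rightarrow> real vec set" where
  "algebraic_set d P = {x \<in> carrier_vec d. eval_mpoly P x = 0}"

definition hyperplane :: "nat \<Rightarrow> int vec \<Rightarrow> int \<Rightarrow> real vec set" where
  "hyperplane d a b = {x \<in> carrier_vec d. map_vec of_int a \<bullet> x + of_int b = 0}"

definition vec_mult_mat :: "real vec \<Rightarrow> real mat \<Rightarrow> real vec" where
  "vec_mult_mat p A = vec (dim_col A) (\<lambda>j. p \<bullet> col A j)"

definition orbit :: "real vec \<Rightarrow> rat mat \<Rightarrow> real vec set" where
  "orbit p M = {vec_mult_mat p (map_mat of_rat M ^\<^sub>m n) | n. n \<ge> 1}"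

text \<open>The disjunction expresses that the intersection has at least \<open>m\<close> points:
  it may be infinite, in which case \<open>card\<close> would return 0.\<close>

definition multiple_reachable ::
    "real vec set \<Rightarrow> real vec set \<Rightarrow> rat mat \<Rightarrow> nat \<Rightarrow> bool" where
  "multiple_reachable S T M m \<longleftrightarrow>
    (\<exists>p \<in> S. infinite (orbit p M \<inter> T) \<or> card (orbit p M \<inter> T) \<ge> m)"

definition encode_mpoly :: "int_mpoly \<Rightarrow> nat" where
  "encode_mpoly P =
    list_encode (map (\<lambda>(c, e). prod_encode (int_encode c, list_encode e)) P)"

definition encode_int_vec :: "int vec \<Rightarrow> nat" where
  "encode_int_vec a = list_encode (map int_encode (list_of_vec a))"

definition encode_rat :: "rat \<Rightarrow> nat" where
  "encode_rat q = (case quotient_of q of (r, s) \<Rightarrow> prod_encode (int_encode r, int_encode s))"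

definition encode_rat_mat :: "rat mat \<Rightarrow> nat" where
  "encode_rat_mat M = list_encode (map (\<lambda>r. list_encode (map encode_rat r)) (mat_to_list M))"

definition encode_input ::
    "nat \<Rightarrow> int_mpoly \<Rightarrow> int vec \<Rightarrow> int \<Rightarrow> rat mat \<Rightarrow> nat \<Rightarrow> nat" where
  "encode_input d P a b M m =
    list_encode [d, encode_mpoly P, encode_int_vec a, int_encode b, encode_rat_mat M, m]"

lemma encode_mpoly_inject: "encode_mpoly P = encode_mpoly Q \<longleftrightarrow> P = Q"
proof -
  have "inj (\<lambda>(c, e). prod_encode (int_encode c, list_encode e))"
    by (auto simp: inj_def int_encode_eq list_encode_eq)
  then show ?thesis by (simp add: list_encode_eq encode_mpoly_def inj_map_eq_map)
qed

lemma encode_int_vec_inject: "encode_int_vec a = encode_int_vec b \<longleftrightarrow> a = b"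
  unfolding encode_int_vec_def list_encode_eq inj_map_eq_map[OF inj_int_encode]
  by (metis vec_list)

lemma encode_rat_inject: "encode_rat q = encode_rat r \<longleftrightarrow> q = r"
  by (auto simp: encode_rat_def int_encode_eq split: prod.splits intro: quotient_of_inject)

lemma encode_rat_mat_inject:
  assumes "M \<in> carrier_mat d d" "N \<in> carrier_mat d d"
  shows "encode_rat_mat M = encode_rat_mat N \<longleftrightarrow> M = N"
proof
  assume "encode_rat_mat M = encode_rat_mat N"
  moreover have "inj (\<lambda>r. list_encode (map encode_rat r))"
    using inj_map_eq_map[of encode_rat]
    by (simp add: inj_def list_encode_eq encode_rat_inject)
  ultimately have "mat_to_list M = mat_to_list N"
    by (simp add: encode_rat_mat_def list_encode_eq inj_map_eq_map)
  then show "M = N"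
    using assms by (intro eq_matI) (auto simp: mat_to_list_def)
qed simp

lemma encode_input_inject:
  assumes "M \<in> carrier_mat d d" "M' \<in> carrier_mat d' d'"
    and "encode_input d P a b M m = encode_input d' P' a' b' M' m'"
  shows "d = d' \<and> P = P' \<and> a = a' \<and> b = b' \<and> M = M' \<and> m = m'"
  using assms encode_rat_mat_inject
  by (auto simp: encode_input_def int_encode_eq list_encode_eq encode_mpoly_inject encode_int_vec_inject)

end

theory Submission
  imports Defs "HOL-Number_Theory.Number_Theory"
begin

text \<open>
  The graph of every recursive function has a Davis normal form, that is, it is obtained from a
  polynomial equation over the natural numbers by existential quantifiers and one bounded
  universal quantifier. The bounded quantifier is eliminated as by Davis, Putnam and Robinson,
  at the price of the additional predicate \<open>y = 2 ^ x\<close>. Orbits can express this predicate: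
  the coefficients \<open>c a b\<close> of \<open>t ^ a * (2 ^ t) ^ b\<close> in the product of all
  \<open>(t - x i)\<^sup>2 + (2 ^ t - y i)\<^sup>2\<close> for \<open>i < n\<close> are integer polynomials in the \<open>x i\<close> and \<open>y i\<close>, and
  the value of the product at time \<open>t\<close> is a linear function of the \<open>t\<close>-th point of the orbit of a
  vector with entries \<open>c a b\<close> under a fixed matrix. It vanishes at \<open>n\<close> positive times \<open>t\<close>
  if and only if the \<open>x i\<close> are distinct positive integers and \<open>y i = 2 ^ x i\<close>. Hence the real
  algebraic set and the number of hits together express existential quantification over the
  natural numbers. A recursive function that decides the problem contradicts itself when it is
  applied, by diagonalization, to the instance that expresses its own negative answer.
\<close>

section \<open>Existential polynomial relations\<close>

text \<open>Real zeros of a polynomial say nothing about integers: integrality has to come from the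
  hits alone, and an instance demands only a fixed number of them. The relation must therefore have
  a fixed number of unknowns, which a bounded universal quantifier prevents, as it asks for a group
  of witnesses for each value of its variable. Exponentials between unknowns, on the other hand, are
  harmless, since each hit certifies a number together with its power of two. Hit times are distinct
  and positive, whereas unknowns may coincide or vanish; they are therefore stored with offsets,
  which are multiples of an auxiliary number, and the power relation is translated accordingly. The
  diagonal instance looks circular: its polynomial describes the behaviour of the decision program
  on codes that contain parts of this very polynomial. The circle is broken by a parameter that
  carries dimension, polynomial, normal vector and matrix as data and enters the polynomial only
  through the coefficients of two terms. The code of the instance is then a simple arithmetic
  function of the parameter and its components.\<close>

datatype 'v pexp = Var 'v | Const int | Add "'v pexp" "'v pexp" | Mul "'v pexp" "'v pexp"

primrec peval :: "('v \<Rightarrow> 'a::comm_ring_1) \<Rightarrow> 'v pexp \<Rightarrow> 'a" where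
  "peval e (Var v) = e v"
| "peval e (Const c) = of_int c"
| "peval e (Add p q) = peval e p + peval e q"
| "peval e (Mul p q) = peval e p * peval e q"

primrec psubst :: "('v \<Rightarrow> 'w pexp) \<Rightarrow> 'v pexp \<Rightarrow> 'w pexp" where
  "psubst s (Var v) = s v"
| "psubst s (Const c) = Const c"
| "psubst s (Add p q) = Add (psubst s p) (psubst s q)"
| "psubst s (Mul p q) = Mul (psubst s p) (psubst s q)"

text \<open>A majorant: with nonnegative coefficients the value is monotone in nonnegative
  arguments, so bounds on the arguments yield a bound on the value that is itself
  polynomial.\<close>

primrec pabs :: "'v pexp \<Rightarrow> 'v pexp" where
  "pabs (Var v) = Var v"
| "pabs (Const c) = Const \<bar>c\<bar>"
| "pabs (Add p q) = Add (pabs p) (pabs q)"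
| "pabs (Mul p q) = Mul (pabs p) (pabs q)"

definition pdiff :: "'v pexp \<Rightarrow> 'v pexp \<Rightarrow> 'v pexp" where
  "pdiff p q = Add p (Mul (Const (-1)) q)"

definition psq :: "'v pexp \<Rightarrow> 'v pexp" where
  "psq p = Mul p p"

definition psum :: "'v pexp list \<Rightarrow> 'v pexp" where
  "psum ps = foldr Add ps (Const 0)"

lemma peval_pdiff [simp]: "peval e (pdiff p q) = peval e p - peval e q"
  by (simp add: pdiff_def)

lemma peval_psq [simp]: "peval e (psq p) = (peval e p)\<^sup>2"
  by (simp add: psq_def power2_eq_square)

lemma peval_psum [simp]: "peval e (psum ps) = (\<Sum>p\<leftarrow>ps. peval e p)"
  by (induction ps) (auto simp: psum_def)

lemma peval_psubst [simp]: "peval e (psubst s p) = peval (\<lambda>v. peval e (s v)) p"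
  by (induction p) auto

lemma peval_map_pexp [simp]: "peval e (map_pexp f p) = peval (\<lambda>v. e (f v)) p"
  by (induction p) auto

lemma peval_cong: "(\<And>v. v \<in> set_pexp p \<Longrightarrow> e v = e' v) \<Longrightarrow> peval e p = peval e' p"
  by (induction p) auto

lemma finite_set_pexp [simp]: "finite (set_pexp p)"
  by (induction p) auto

lemma set_pexp_pdiff [simp]: "set_pexp (pdiff p q) = set_pexp p \<union> set_pexp q"
  by (simp add: pdiff_def)

lemma set_pexp_psq [simp]: "set_pexp (psq p) = set_pexp p"
  by (simp add: psq_def)

lemma set_pexp_psum [simp]: "set_pexp (psum ps) = (\<Union>p\<in>set ps. set_pexp p)"
  by (induction ps) (auto simp: psum_def)

lemma set_pexp_psubst: "set_pexp (psubst s p) = (\<Union>v\<in>set_pexp p. set_pexp (s v))"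
  by (induction p) auto

lemma peval_of_int: "peval (\<lambda>v. of_int (e v)) p = of_int (peval e p)"
  by (induction p) auto

lemma peval_cong_mod:
  fixes e :: "'v \<Rightarrow> int"
  assumes "\<And>v. v \<in> set_pexp p \<Longrightarrow> [e v = e' v] (mod m)"
  shows "[peval e p = peval e' p] (mod m)"
  using assms by (induction p) (auto intro: cong_add cong_mult)

lemma abs_peval_le:
  fixes e :: "'v \<Rightarrow> int"
  assumes "\<And>v. v \<in> set_pexp p \<Longrightarrow> \<bar>e v\<bar> \<le> e' v"
  shows "\<bar>peval e p\<bar> \<le> peval e' (pabs p)"
  using assms
proof (induction p)
  case (Add p q)
  then have "\<bar>peval e p\<bar> \<le> peval e' (pabs p)" "\<bar>peval e q\<bar> \<le> peval e' (pabs q)"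
    by auto
  then show ?case by simp
next
  case (Mul p q)
  then have "\<bar>peval e p\<bar> \<le> peval e' (pabs p)" "\<bar>peval e q\<bar> \<le> peval e' (pabs q)"
    by auto
  then show ?case by (auto simp: abs_mult intro!: mult_mono)
qed auto

text \<open>Environments \<open>r\<close> act as de Bruijn contexts: a quantifier takes position 0
  and shifts the others. Polynomial functions are the terms that may be substituted for
  positions.\<close>

definition poly_fun :: "((nat \<Rightarrow> nat) \<Rightarrow> nat) \<Rightarrow> bool" where
  "poly_fun f \<longleftrightarrow> (\<exists>p. \<forall>r. int (f r) = peval (\<lambda>i. int (r i)) p)"

lemma poly_fun_var [simp, intro!]: "poly_fun (\<lambda>r. r i)"
  unfolding poly_fun_def by (rule exI[of _ "Var i"]) simp

lemma poly_fun_const [simp, intro!]: "poly_fun (\<lambda>r. c)"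
  unfolding poly_fun_def by (rule exI[of _ "Const (int c)"]) simp

lemma poly_fun_add [simp, intro]:
  assumes "poly_fun f" "poly_fun g" shows "poly_fun (\<lambda>r. f r + g r)"
proof -
  obtain p q where "\<And>r. int (f r) = peval (\<lambda>i. int (r i)) p" "\<And>r. int (g r) = peval (\<lambda>i. int (r i)) q"
    using assms unfolding poly_fun_def by blast
  then show ?thesis unfolding poly_fun_def by (intro exI[of _ "Add p q"]) simp
qed

lemma poly_fun_mult [simp, intro]:
  assumes "poly_fun f" "poly_fun g" shows "poly_fun (\<lambda>r. f r * g r)"
proof -
  obtain p q where "\<And>r. int (f r) = peval (\<lambda>i. int (r i)) p" "\<And>r. int (g r) = peval (\<lambda>i. int (r i)) q"
    using assms unfolding poly_fun_def by blast
  then show ?thesis unfolding poly_fun_def by (intro exI[of _ "Mul p q"]) simp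
qed

lemma poly_fun_Suc [simp, intro]: "poly_fun f \<Longrightarrow> poly_fun (\<lambda>r. Suc (f r))"
  using poly_fun_add[OF _ poly_fun_const[of 1]] by simp

lemma poly_fun_case_nat [simp, intro]:
  "poly_fun f \<Longrightarrow> (\<And>j. poly_fun (g j)) \<Longrightarrow> poly_fun (\<lambda>r. case i of 0 \<Rightarrow> f r | Suc j \<Rightarrow> g j r)"
  by (cases i) auto

text \<open>The flag \<open>b\<close> admits the additional relation \<open>y = 2 ^ x\<close> between quantified variables.\<close>

definition dioph :: "bool \<Rightarrow> ((nat \<Rightarrow> nat) \<Rightarrow> bool) \<Rightarrow> bool" where
  "dioph b R \<longleftrightarrow> (\<exists>(p :: (nat + nat) pexp) ps. (b \<or> ps = []) \<and> (\<forall>r. R r \<longleftrightarrow>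
     (\<exists>w. (\<forall>(x, y) \<in> set ps. w y = 2 ^ w x) \<and>
        peval (\<lambda>v. int (case_sum r w v)) p = 0)))"

lemma diophE:
  assumes "dioph b R"
  obtains p :: "(nat + nat) pexp" and ps where "b \<or> ps = []"
    "\<And>r. R r \<longleftrightarrow> (\<exists>w. (\<forall>(x, y) \<in> set ps. w y = 2 ^ w x) \<and>
        peval (\<lambda>v. int (case_sum r w v)) p = 0)"
  using assms unfolding dioph_def by blast

lemma diophI:
  fixes p :: "(nat + nat) pexp"
  assumes "b \<or> ps = []"
    "\<And>r. R r \<longleftrightarrow> (\<exists>w. (\<forall>(x, y) \<in> set ps. w y = 2 ^ w x) \<and>
        peval (\<lambda>v. int (case_sum r w v)) p = 0)"
  shows "dioph b R"
  unfolding dioph_def by (rule exI[of _ p], rule exI[of _ ps], rule conjI, rule assms(1), rule allI, rule assms(2))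

lemma dioph_FalseE:
  assumes "dioph False R"
  obtains p :: "(nat + nat) pexp" where "\<And>r. R r \<longleftrightarrow> (\<exists>w. peval (\<lambda>v. int (case_sum r w v)) p = 0)"
proof (rule diophE[OF assms])
  fix p :: "(nat + nat) pexp" and ps
  assume "False \<or> ps = []" and
    R: "\<And>r. R r \<longleftrightarrow> (\<exists>w. (\<forall>(x, y) \<in> set ps. w y = 2 ^ w x) \<and>
        peval (\<lambda>v. int (case_sum r w v)) p = 0)"
  then have "ps = []" by simp
  show thesis
    by (rule that[of p]) (simp add: R \<open>ps = []\<close>)
qed

lemma dioph_eq [intro]:
  assumes "poly_fun f" "poly_fun g"
  shows "dioph b (\<lambda>r. f r = g r)"
proof -
  obtain p q where p: "\<And>r. int (f r) = peval (\<lambda>i. int (r i)) p" "\<And>r. int (g r) = peval (\<lambda>i. int (r i)) q"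
    using assms unfolding poly_fun_def by blast
  show ?thesis
    by (rule diophI[of _ "[]" _ "pdiff (map_pexp Inl p) (map_pexp Inl q)"])
      (auto simp flip: p)
qed

lemma dioph_subst:
  assumes "dioph b R" "\<And>i. poly_fun (\<sigma> i)"
  shows "dioph b (\<lambda>r. R (\<lambda>i. \<sigma> i r))"
proof -
  from assms(2) obtain q where q: "\<And>i r. int (\<sigma> i r) = peval (\<lambda>i. int (r i)) (q i)"
    unfolding poly_fun_def by metis
  obtain p :: "(nat + nat) pexp" and ps where ps: "b \<or> ps = []"
    "\<And>r. R r \<longleftrightarrow> (\<exists>w. (\<forall>(x, y) \<in> set ps. w y = 2 ^ w x) \<and>
        peval (\<lambda>v. int (case_sum r w v)) p = 0)"
    by (rule diophE[OF assms(1)], rule that, assumption+)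
  have *: "peval (\<lambda>v. int (case_sum r w v)) (psubst (case_sum (\<lambda>i. map_pexp Inl (q i)) (\<lambda>j. Var (Inr j))) p)
     = peval (\<lambda>v. int (case_sum (\<lambda>i. \<sigma> i r) w v)) p" for r w
    unfolding peval_psubst by (rule peval_cong) (auto simp: q split: sum.splits)
  show ?thesis
    by (rule diophI[OF ps(1), where p = "psubst (case_sum (\<lambda>i. map_pexp Inl (q i)) (\<lambda>j. Var (Inr j))) p"])
      (simp only: * ps(2))
qed

text \<open>An infinite vector of quantified variables is harmless, as only finitely many can occur.\<close>

lemma dioph_ex_vec:
  assumes "dioph b (\<lambda>r. R (\<lambda>i. r (2 * i + 1)) (\<lambda>i. r (2 * i)))"
  shows "dioph b (\<lambda>r. \<exists>A. R A r)"
proof -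
  obtain p :: "(nat + nat) pexp" and ps where ps: "b \<or> ps = []" and
    R: "\<And>r. R (\<lambda>i. r (2 * i + 1)) (\<lambda>i. r (2 * i)) \<longleftrightarrow>
      (\<exists>w. (\<forall>(x, y) \<in> set ps. w y = 2 ^ w x) \<and> peval (\<lambda>v. int (case_sum r w v)) p = 0)"
    by (rule diophE[OF assms], rule that, assumption+)
  define mix where "mix f g i = (if even i then f (i div 2) else g (i div 2))"
    for f g :: "nat \<Rightarrow> nat" and i :: nat
  have mix_even: "(\<lambda>i. mix f g (2 * i)) = f" and mix_odd: "(\<lambda>i. mix f g (2 * i + 1)) = g" for f g
    by (auto simp: mix_def fun_eq_iff)
  have R': "R A r \<longleftrightarrow> (\<exists>w. (\<forall>(x, y) \<in> set ps. w y = 2 ^ w x) \<and>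
      peval (\<lambda>v. int (case_sum (mix r A) w v)) p = 0)" for r A
    using R[of "mix r A"] by (simp add: mix_def)
  \<comment> \<open>Odd free positions belong to the vector and become witnesses with odd indices;
    the old witnesses move to even indices, so the power pairs are merely doubled.\<close>
  define \<sigma> where "\<sigma> = (\<lambda>v. case v of Inl i \<Rightarrow> if even i then Inl (i div 2) else Inr (2 * (i div 2) + 1)
    | Inr j \<Rightarrow> Inr (2 * j :: nat))"
  have \<sigma>: "peval (\<lambda>v. int (case_sum r u v)) (map_pexp \<sigma> p) =
    peval (\<lambda>v. int (case_sum (mix r (\<lambda>i. u (2 * i + 1))) (\<lambda>i. u (2 * i)) v)) p" for r u
    unfolding peval_map_pexp by (rule peval_cong) (auto simp: \<sigma>_def mix_def split: sum.splits)
  show ?thesis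
  proof (rule diophI[where p = "map_pexp \<sigma> p" and ps = "map (\<lambda>(x, y). (2 * x, 2 * y)) ps"])
    show "b \<or> map (\<lambda>(x, y). (2 * x, 2 * y)) ps = []" using ps by auto
    fix r
    show "(\<exists>A. R A r) \<longleftrightarrow> (\<exists>u. (\<forall>(x, y)\<in>set (map (\<lambda>(x, y). (2 * x, 2 * y)) ps). u y = 2 ^ u x) \<and>
           peval (\<lambda>v. int (case_sum r u v)) (map_pexp \<sigma> p) = 0)"
    proof
      assume "\<exists>A. R A r"
      then obtain A w where w: "\<forall>(x, y) \<in> set ps. w y = 2 ^ w x"
        "peval (\<lambda>v. int (case_sum (mix r A) w v)) p = 0"
        unfolding R' by blast
      then show "\<exists>u. (\<forall>(x, y)\<in>set (map (\<lambda>(x, y). (2 * x, 2 * y)) ps). u y = 2 ^ u x) \<and>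
           peval (\<lambda>v. int (case_sum r u v)) (map_pexp \<sigma> p) = 0"
        unfolding \<sigma> by (intro exI[of _ "mix w A"], unfold mix_even mix_odd) (auto simp: mix_def)
    next
      assume "\<exists>u. (\<forall>(x, y)\<in>set (map (\<lambda>(x, y). (2 * x, 2 * y)) ps). u y = 2 ^ u x) \<and>
           peval (\<lambda>v. int (case_sum r u v)) (map_pexp \<sigma> p) = 0"
      then obtain u where "(\<forall>(x, y)\<in>set (map (\<lambda>(x, y). (2 * x, 2 * y)) ps). u y = 2 ^ u x)"
        "peval (\<lambda>v. int (case_sum r u v)) (map_pexp \<sigma> p) = 0" by blast
      then show "\<exists>A. R A r"
        unfolding R' \<sigma> by (intro exI[of _ "\<lambda>i. u (2 * i + 1)"] exI[of _ "\<lambda>i. u (2 * i)"]) (auto simp: case_prod_beta)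
    qed
  qed
qed

text \<open>A single variable is component 0 of a quantified vector whose other components are
  ignored.\<close>

lemma dioph_ex [intro]:
  assumes "dioph b (\<lambda>r. R (r 0) (\<lambda>i. r (Suc i)))"
  shows "dioph b (\<lambda>r. \<exists>x. R x r)"
proof -
  define \<sigma> :: "nat \<Rightarrow> (nat \<Rightarrow> nat) \<Rightarrow> nat"
    where "\<sigma> i r = (case i of 0 \<Rightarrow> r 1 | Suc j \<Rightarrow> r (2 * j))" for i r
  have "poly_fun (\<sigma> i)" for i
    by (cases i) (auto simp: \<sigma>_def[abs_def])
  from dioph_subst[OF assms, of \<sigma>, OF this]
  have "dioph b (\<lambda>r. R ((\<lambda>i. r (2 * i + 1)) 0) (\<lambda>i. r (2 * i)))"
    by (simp add: \<sigma>_def)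
  from dioph_ex_vec[OF this] have "dioph b (\<lambda>r. \<exists>A. R (A (0::nat)) r)" .
  moreover have "(\<exists>A. R (A (0::nat)) r) \<longleftrightarrow> (\<exists>x. R x r)" for r
  proof
    assume "\<exists>x. R x r"
    then obtain x where "R x r" ..
    then show "\<exists>A. R (A (0::nat)) r" by (intro exI[of _ "\<lambda>_. x"])
  qed blast
  ultimately show ?thesis by simp
qed

text \<open>A sum of two integer squares vanishes only if both do. Even and odd indices keep the
  witnesses and the power pairs of the two relations apart.\<close>

lemma dioph_conj [intro]:
  assumes "dioph b R" "dioph b S"
  shows "dioph b (\<lambda>r. R r \<and> S r)"
proof -
  obtain p :: "(nat + nat) pexp" and ps where ps: "b \<or> ps = []" and
    R: "\<And>r. R r \<longleftrightarrow> (\<exists>w. (\<forall>(x, y) \<in> set ps. w y = 2 ^ w x) \<and> peval (\<lambda>v. int (case_sum r w v)) p = 0)"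
    by (rule diophE[OF assms(1)], rule that, assumption+)
  obtain q :: "(nat + nat) pexp" and qs where qs: "b \<or> qs = []" and
    S: "\<And>r. S r \<longleftrightarrow> (\<exists>w. (\<forall>(x, y) \<in> set qs. w y = 2 ^ w x) \<and> peval (\<lambda>v. int (case_sum r w v)) q = 0)"
    by (rule diophE[OF assms(2)], rule that, assumption+)
  define \<sigma> \<tau> where "\<sigma> = map_sum (\<lambda>i::nat. i) (\<lambda>j::nat. 2 * j)" and "\<tau> = map_sum (\<lambda>i::nat. i) (\<lambda>j::nat. 2 * j + 1)"
  have \<sigma>: "peval (\<lambda>v. int (case_sum r w v)) (map_pexp \<sigma> p) = peval (\<lambda>v. int (case_sum r (\<lambda>i. w (2 * i)) v)) p" for r w
    unfolding peval_map_pexp by (rule peval_cong) (auto simp: \<sigma>_def split: sum.splits)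
  have \<tau>: "peval (\<lambda>v. int (case_sum r w v)) (map_pexp \<tau> q) = peval (\<lambda>v. int (case_sum r (\<lambda>i. w (2 * i + 1)) v)) q" for r w
    unfolding peval_map_pexp by (rule peval_cong) (auto simp: \<tau>_def split: sum.splits)
  define mix where "mix f g i = (if even i then f (i div 2) else g (i div 2))"
    for f g :: "nat \<Rightarrow> nat" and i :: nat
  have mix_even: "(\<lambda>i. mix f g (2 * i)) = f" and mix_odd: "(\<lambda>i. mix f g (2 * i + 1)) = g" for f g
    by (auto simp: mix_def fun_eq_iff)
  let ?ps = "map (map_prod (\<lambda>j. 2 * j) (\<lambda>j. 2 * j)) ps @ map (map_prod (\<lambda>j. 2 * j + 1) (\<lambda>j. 2 * j + 1)) qs"
  show ?thesis
  proof (rule diophI[where ps = ?ps and p = "Add (psq (map_pexp \<sigma> p)) (psq (map_pexp \<tau> q))"])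
    show "b \<or> ?ps = []" using ps qs by auto
    fix r
    show "(R r \<and> S r) \<longleftrightarrow> (\<exists>w. (\<forall>(x, y)\<in>set ?ps. w y = 2 ^ w x) \<and>
          peval (\<lambda>v. int (case_sum r w v)) (Add (psq (map_pexp \<sigma> p)) (psq (map_pexp \<tau> q))) = 0)"
    proof
      assume "R r \<and> S r"
      then obtain u w where "\<forall>(x, y) \<in> set ps. u y = 2 ^ u x" "peval (\<lambda>v. int (case_sum r u v)) p = 0"
        "\<forall>(x, y) \<in> set qs. w y = 2 ^ w x" "peval (\<lambda>v. int (case_sum r w v)) q = 0"
        unfolding R S by blast
      then show "\<exists>w. (\<forall>(x, y)\<in>set ?ps. w y = 2 ^ w x) \<and>
          peval (\<lambda>v. int (case_sum r w v)) (Add (psq (map_pexp \<sigma> p)) (psq (map_pexp \<tau> q))) = 0"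
        by (intro exI[of _ "mix u w"], unfold peval.simps peval_psq \<sigma> \<tau> mix_even mix_odd) (auto simp: mix_def)
    next
      assume "\<exists>w. (\<forall>(x, y)\<in>set ?ps. w y = 2 ^ w x) \<and>
          peval (\<lambda>v. int (case_sum r w v)) (Add (psq (map_pexp \<sigma> p)) (psq (map_pexp \<tau> q))) = 0"
      then obtain w where w: "\<forall>(x, y)\<in>set ?ps. w y = 2 ^ w x"
        "peval (\<lambda>v. int (case_sum r (\<lambda>i. w (2 * i)) v)) p = 0"
        "peval (\<lambda>v. int (case_sum r (\<lambda>i. w (2 * i + 1)) v)) q = 0"
        by (auto simp: \<sigma> \<tau> simp del: peval_map_pexp)
      have "R r" unfolding R using w
        by (intro exI[of _ "\<lambda>i. w (2 * i)"]) (auto simp: case_prod_beta ball_Un)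
      moreover have "S r" unfolding S using w
        by (intro exI[of _ "\<lambda>i. w (2 * i + 1)"]) (auto simp: case_prod_beta ball_Un)
      ultimately show "R r \<and> S r" ..
    qed
  qed
qed

text \<open>The product of the two polynomials works, with shared witnesses. In the presence of
  power pairs this argument would break, as the pairs of both disjuncts would be imposed at
  once.\<close>

lemma dioph_disj [intro]:
  assumes "dioph False R" "dioph False S"
  shows "dioph False (\<lambda>r. R r \<or> S r)"
proof -
  obtain p :: "(nat + nat) pexp" where
    R: "\<And>r. R r \<longleftrightarrow> (\<exists>w. peval (\<lambda>v. int (case_sum r w v)) p = 0)"
    by (rule dioph_FalseE[OF assms(1)], rule that, assumption+)
  obtain q :: "(nat + nat) pexp" where
    S: "\<And>r. S r \<longleftrightarrow> (\<exists>w. peval (\<lambda>v. int (case_sum r w v)) q = 0)"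
    by (rule dioph_FalseE[OF assms(2)], rule that, assumption+)
  show ?thesis
    by (rule diophI[where ps = "[]" and p = "Mul p q"]) (auto simp: R S)
qed

lemma dioph_True [simp, intro!]: "dioph b (\<lambda>r. True)"
  using dioph_eq[of "\<lambda>r. 0" "\<lambda>r. 0" b] by simp

text \<open>Here \<open>n\<close> is a constant of the formula, so this is a finite conjunction and
  not a genuine bounded quantifier.\<close>

lemma dioph_all_less:
  assumes "\<And>j. j < (n::nat) \<Longrightarrow> dioph b (R j)"
  shows "dioph b (\<lambda>r. \<forall>j<n. R j r)"
  using assms
proof (induction n)
  case (Suc n)
  then have "dioph b (\<lambda>r. (\<forall>j<n. R j r) \<and> R n r)" by auto
  then show ?case by (simp add: All_less_Suc conj_commute)
qed auto

text \<open>Power pairs relate quantified variables only, so the two free variables are copied: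
  index 0 holds the exponent, index 1 the power.\<close>

lemma dioph_pow2: "dioph True (\<lambda>r. r 0 = 2 ^ r 1)"
proof (rule diophI[where ps = "[(0, 1)]" and
      p = "Add (psq (pdiff (Var (Inl 0)) (Var (Inr 1)))) (psq (pdiff (Var (Inl 1)) (Var (Inr 0))))"])
  fix r :: "nat \<Rightarrow> nat"
  show "(r 0 = 2 ^ r 1) \<longleftrightarrow> (\<exists>w :: nat \<Rightarrow> nat. (\<forall>(x, y)\<in>set [(0, 1)]. w y = 2 ^ w x) \<and>
      peval (\<lambda>v. int (case_sum r w v)) (Add (psq (pdiff (Var (Inl 0)) (Var (Inr 1)))) (psq (pdiff (Var (Inl 1)) (Var (Inr 0))))) = 0)"
    (is "_ = (\<exists>w. ?P w)")
  proof
    assume "r 0 = 2 ^ r 1"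
    then show "\<exists>w. ?P w"
      by (intro exI[of _ "\<lambda>i. if i = 0 then r 1 else r 0"]) simp
  next
    assume "\<exists>w. ?P w"
    then obtain w where "?P w" ..
    then have "w 1 = 2 ^ w 0" "(int (r 0) - int (w 1))\<^sup>2 + (int (r 1) - int (w 0))\<^sup>2 = 0"
      by simp_all
    then show "r 0 = 2 ^ r 1"
      by (metis add_nonneg_eq_0_iff of_nat_eq_iff power2_less_eq_zero_iff power_zero_numeral
         eq_iff_diff_eq_0 zero_le_power2 power_eq_0_iff)
  qed
qed simp

lemma poly_fun_subst:
  assumes "poly_fun f" "\<And>i. poly_fun (\<sigma> i)"
  shows "poly_fun (\<lambda>r. f (\<lambda>i. \<sigma> i r))"
proof -
  obtain p where p: "\<And>r. int (f r) = peval (\<lambda>i. int (r i)) p"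
    using assms(1) unfolding poly_fun_def by blast
  obtain q where "\<And>i r. int (\<sigma> i r) = peval (\<lambda>i. int (r i)) (q i)"
    using assms(2) unfolding poly_fun_def by metis
  then show ?thesis
    unfolding poly_fun_def by (intro exI[of _ "psubst q p"]) (simp add: p)
qed

lemma poly_fun_shift: "poly_fun f \<Longrightarrow> poly_fun (\<lambda>r. f (\<lambda>i. r (Suc i)))"
  by (rule poly_fun_subst) auto

section \<open>Functions with an existentially definable graph\<close>

definition dioph_fun :: "bool \<Rightarrow> ((nat \<Rightarrow> nat) \<Rightarrow> nat) \<Rightarrow> bool" where
  "dioph_fun b f \<longleftrightarrow> dioph b (\<lambda>r. r 0 = f (\<lambda>i. r (Suc i)))"

lemma dioph_fun_poly [simp, intro]: "poly_fun f \<Longrightarrow> dioph_fun b f"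
  unfolding dioph_fun_def by (intro dioph_eq poly_fun_shift) auto

lemma dioph_fun_shift:
  assumes "dioph_fun b f"
  shows "dioph_fun b (\<lambda>r. f (\<lambda>i. r (Suc i)))"
proof -
  have "dioph b (\<lambda>r. r 0 = f (\<lambda>i. r (Suc (Suc i))))"
    using dioph_subst[OF assms[unfolded dioph_fun_def], of "\<lambda>i r. case i of 0 \<Rightarrow> r 0 | Suc j \<Rightarrow> r (Suc (Suc j))"]
    by (simp split: nat.splits)
  then show ?thesis unfolding dioph_fun_def .
qed

text \<open>\<open>dioph_subst\<close> accepts polynomial arguments only; other arguments are named
  by quantified variables that satisfy their graphs. The swap is due to the last bound variable
  being at position 0.\<close>

lemma dioph_app2:
  assumes "dioph b (\<lambda>r. R (r 0) (r 1))" "dioph_fun b f" "dioph_fun b g"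
  shows "dioph b (\<lambda>r. R (f r) (g r))"
proof -
  have "dioph b (\<lambda>r. R (r 1) (r 0))"
    using dioph_subst[OF assms(1), of "\<lambda>i r. case i of 0 \<Rightarrow> r 1 | _ \<Rightarrow> r 0"]
    by (simp split: nat.splits)
  then have "dioph b (\<lambda>r. \<exists>x. x = f r \<and> (\<exists>y. y = g r \<and> R x y))"
    using assms(2) dioph_fun_shift[OF assms(3)]
    unfolding dioph_fun_def by (intro dioph_ex dioph_conj) auto
  then show ?thesis by simp
qed

lemma dioph_app3:
  assumes "dioph b (\<lambda>r. R (r 0) (r 1) (r 2))" "dioph_fun b f" "dioph_fun b g" "dioph_fun b h"
  shows "dioph b (\<lambda>r. R (f r) (g r) (h r))"
proof -
  have "dioph b (\<lambda>r. R (r 2) (r 1) (r 0))"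
    using dioph_subst[OF assms(1), of "\<lambda>i r. r (2 - i)"] by simp
  then have "dioph b (\<lambda>r. \<exists>x. x = f r \<and> (\<exists>y. y = g r \<and> (\<exists>z. z = h r \<and> R x y z)))"
    using assms(2) dioph_fun_shift[OF assms(3)] dioph_fun_shift[OF dioph_fun_shift[OF assms(4)]]
    unfolding dioph_fun_def by (intro dioph_ex dioph_conj) (auto simp: numeral_2_eq_2)
  then show ?thesis by simp
qed

lemma dioph_fun_app1:
  assumes "dioph b (\<lambda>r. r 0 = F (r 1))" "dioph_fun b f"
  shows "dioph_fun b (\<lambda>r. F (f r))"
  unfolding dioph_fun_def by (rule dioph_app2[OF assms(1)]) (auto intro: dioph_fun_shift assms)

lemma dioph_fun_app2:
  assumes "dioph b (\<lambda>r. r 0 = F (r 1) (r 2))" "dioph_fun b f" "dioph_fun b g"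
  shows "dioph_fun b (\<lambda>r. F (f r) (g r))"
  unfolding dioph_fun_def by (rule dioph_app3[OF assms(1)]) (auto intro: dioph_fun_shift assms)

lemma dioph_fun_add [intro]: "dioph_fun b f \<Longrightarrow> dioph_fun b g \<Longrightarrow> dioph_fun b (\<lambda>r. f r + g r)"
  by (rule dioph_fun_app2) auto

lemma dioph_fun_mult [intro]: "dioph_fun b f \<Longrightarrow> dioph_fun b g \<Longrightarrow> dioph_fun b (\<lambda>r. f r * g r)"
  by (rule dioph_fun_app2) auto

lemma dioph_fun_Suc [intro]: "dioph_fun b f \<Longrightarrow> dioph_fun b (\<lambda>r. Suc (f r))"
  by (rule dioph_fun_app1) auto

lemma dioph_fun_pow2 [intro]: "dioph_fun True f \<Longrightarrow> dioph_fun True (\<lambda>r. 2 ^ f r)"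
  by (rule dioph_fun_app1[OF dioph_pow2])

lemma dioph_fun_eq [intro]: "dioph_fun b f \<Longrightarrow> dioph_fun b g \<Longrightarrow> dioph b (\<lambda>r. f r = g r)"
  by (rule dioph_app2) auto

lemma dioph_fun_le [intro]:
  assumes "dioph_fun b f" "dioph_fun b g"
  shows "dioph b (\<lambda>r. f r \<le> g r)"
proof (rule dioph_app2[OF _ assms])
  have "dioph b (\<lambda>r. \<exists>x. r 1 = r 0 + x)"
    by (intro dioph_ex dioph_eq) auto
  then show "dioph b (\<lambda>r. r 0 \<le> r 1)" by (simp add: le_iff_add)
qed

lemma dioph_fun_less [intro]: "dioph_fun b f \<Longrightarrow> dioph_fun b g \<Longrightarrow> dioph b (\<lambda>r. f r < g r)"
  unfolding less_eq_Suc_le by auto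

lemma dioph_fun_dvd [intro]:
  assumes "dioph_fun b f" "dioph_fun b g"
  shows "dioph b (\<lambda>r. f r dvd g r)"
proof (rule dioph_app2[OF _ assms])
  have "dioph b (\<lambda>r. \<exists>x. r 1 = r 0 * x)"
    by (intro dioph_ex dioph_eq) auto
  then show "dioph b (\<lambda>r. r 0 dvd r 1)" by (simp add: dvd_def)
qed

lemma dioph_fun_diff:
  assumes "dioph_fun b f" "dioph_fun b g" "\<And>r. g r \<le> f r"
  shows "dioph_fun b (\<lambda>r. f r - g r)"
proof -
  have "dioph b (\<lambda>r. r 0 + g (\<lambda>i. r (Suc i)) = f (\<lambda>i. r (Suc i)))"
    using assms(1,2) by (intro dioph_fun_eq dioph_fun_add dioph_fun_shift) auto
  moreover have "r 0 + g (\<lambda>i. r (Suc i)) = f (\<lambda>i. r (Suc i)) \<longleftrightarrow> r 0 = f (\<lambda>i. r (Suc i)) - g (\<lambda>i. r (Suc i))"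
    for r :: "nat \<Rightarrow> nat"
    using assms(3)[of "\<lambda>i. r (Suc i)"] by auto
  ultimately show ?thesis unfolding dioph_fun_def by simp
qed

lemma dioph_fun_div:
  assumes "dioph_fun b f" "dioph_fun b g" "\<And>r. g r > 0"
  shows "dioph_fun b (\<lambda>r. f r div g r)"
proof -
  let ?s = "\<lambda>r i. r (Suc i)"
  have "dioph b (\<lambda>r. r 0 * g (?s r) \<le> f (?s r) \<and> f (?s r) < Suc (r 0) * g (?s r))"
    using assms(1,2) by (intro dioph_conj dioph_fun_le dioph_fun_less dioph_fun_mult dioph_fun_shift) auto
  moreover have "(r 0 * g (?s r) \<le> f (?s r) \<and> f (?s r) < Suc (r 0) * g (?s r)) \<longleftrightarrow> r 0 = f (?s r) div g (?s r)"
    for r :: "nat \<Rightarrow> nat"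
    using assms(3)[of "?s r"]
    by (metis div_nat_eqI div_times_less_eq_dividend dividend_less_div_times mult.commute mult_Suc)
  ultimately show ?thesis unfolding dioph_fun_def by simp
qed

lemma dioph_fun_mod:
  assumes "dioph_fun b f" "dioph_fun b g" "\<And>r. g r > 0"
  shows "dioph_fun b (\<lambda>r. f r mod g r)"
proof -
  have "dioph_fun b (\<lambda>r. f r - f r div g r * g r)"
    using assms by (intro dioph_fun_diff dioph_fun_mult dioph_fun_div) auto
  then show ?thesis by (simp add: minus_div_mult_eq_mod)
qed

section \<open>Davis normal form of recursive functions\<close>

lemma poly_fun_if: "poly_fun f \<Longrightarrow> poly_fun g \<Longrightarrow> poly_fun (\<lambda>r. if c then f r else g r)"
  by (cases c) auto

lemma triangle_mono: "m \<le> n \<Longrightarrow> triangle m \<le> triangle n"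
  unfolding triangle_def by (intro div_le_mono mult_le_mono) auto

lemma prod_encode_mono: "a \<le> a' \<Longrightarrow> b \<le> b' \<Longrightarrow> prod_encode (a, b) \<le> prod_encode (a', b')"
  by (auto simp: prod_encode_def intro!: add_mono triangle_mono)

lemma dioph_fun_prod_encode [intro]:
  assumes "dioph_fun b f" "dioph_fun b g"
  shows "dioph_fun b (\<lambda>r. prod_encode (f r, g r))"
proof (rule dioph_fun_app2[OF _ assms])
  have "even ((x + y) * Suc (x + y))" for x y :: nat by simp
  then have eq: "z = prod_encode (x, y) \<longleftrightarrow> 2 * z = (x + y) * Suc (x + y) + 2 * x" for x y z
    unfolding prod_encode_def triangle_def by (auto elim!: evenE)
  show "dioph b (\<lambda>r. r 0 = prod_encode (r 1, r 2))"
    unfolding eq by (intro dioph_eq) auto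
qed

text \<open>Goedel's beta function: two numbers code a sequence of any finite length by its
  remainders.\<close>

definition beta :: "nat \<Rightarrow> nat \<Rightarrow> nat \<Rightarrow> nat" where
  "beta A B i = A mod Suc (Suc i * B)"

lemma ex_beta: "\<exists>A B. \<forall>i<n. beta A B i = w i"
proof -
  \<comment> \<open>\<open>K\<close> bounds the indices, so that their differences divide
    \<open>fact K\<close>, and also the values, so that they are smaller than the moduli.\<close>
  define K where "K = n + (\<Sum>i<n. w i)"
  have wK: "w i \<le> K" if "i < n" for i
    using that member_le_sum[of i "{..<n}" w] by (simp add: K_def)
  define B :: nat where "B = fact K"
  let ?m = "\<lambda>i. Suc (Suc i * B)"
  have cop: "coprime (?m i) (?m j)" if "i < j" "j < n" for i j
  proof (rule coprimeI)
    fix c assume c: "c dvd ?m i" "c dvd ?m j"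
    \<comment> \<open>A combination of the two moduli in which \<open>B\<close> cancels.\<close>
    have "Suc j * ?m i = Suc i * ?m j + (j - i)"
      using \<open>i < j\<close> by (simp add: algebra_simps)
    then have "c dvd j - i"
      using c by (metis dvd_add_right_iff dvd_mult)
    then have "c \<le> K" "c > 0"
      using that by (auto dest: dvd_imp_le simp: K_def intro!: gr0I)
    then have "c dvd B"
      unfolding B_def by (intro dvd_fact) auto
    then have "c dvd Suc i * B" by simp
    then show "is_unit c"
      using c(1) by (metis Suc_eq_plus1 dvd_add_right_iff)
  qed
  then have "coprime (?m i) (?m j)" if "i < n" "j < n" "i \<noteq> j" for i j
    using that by (metis coprime_commute linorder_neqE_nat)
  then obtain A where A: "[A = w i] (mod ?m i)" if "i < n" for i
    using chinese_remainder_nat[of "{..<n}" ?m w] by auto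
  have "beta A B i = w i" if "i < n" for i
  proof -
    have "w i \<le> B"
      using wK[OF that] fact_ge_self[of K] by (simp add: B_def)
    then have "w i < ?m i" by simp
    then show ?thesis
      using A[OF that] by (simp add: beta_def cong_def)
  qed
  then show ?thesis by blast
qed

lemma dioph_fun_beta [intro]:
  assumes "dioph_fun b f" "dioph_fun b g" "dioph_fun b h"
  shows "dioph_fun b (\<lambda>r. beta (f r) (g r) (h r))"
  unfolding beta_def using assms by (intro dioph_fun_mod dioph_fun_Suc dioph_fun_mult) auto

text \<open>The outer existential quantifiers of the normal form are merged into one by pairing.\<close>

definition davis :: "((nat \<Rightarrow> nat) \<Rightarrow> bool) \<Rightarrow> bool" where
  "davis R \<longleftrightarrow> (\<exists>Q. dioph False (\<lambda>r. Q (r 0) (r 1) (\<lambda>i. r (Suc (Suc i)))) \<and>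
     (\<forall>r. R r \<longleftrightarrow> (\<exists>w. \<forall>k\<le>w. Q w k r)))"

text \<open>The inner relation comes with closure under polynomial arguments, so that new inner
  relations can be assembled by introduction rules alone.\<close>

lemma davisE:
  assumes "davis R"
  obtains Q where
    "\<And>f g \<sigma>. poly_fun f \<Longrightarrow> poly_fun g \<Longrightarrow> (\<And>i. poly_fun (\<sigma> i)) \<Longrightarrow>
      dioph False (\<lambda>r. Q (f r) (g r) (\<lambda>i. \<sigma> i r))"
    "\<And>r. R r \<longleftrightarrow> (\<exists>w. \<forall>k\<le>w. Q w k r)"
proof -
  obtain Q where Q: "dioph False (\<lambda>r. Q (r 0) (r 1) (\<lambda>i. r (Suc (Suc i))))"
    "\<forall>r. R r \<longleftrightarrow> (\<exists>w. \<forall>k\<le>w. Q w k r)"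
    using assms unfolding davis_def by blast
  have "dioph False (\<lambda>r. Q (f r) (g r) (\<lambda>i. \<sigma> i r))"
    if "poly_fun f" "poly_fun g" "\<And>i. poly_fun (\<sigma> i)" for f g \<sigma>
    using dioph_subst[OF Q(1), of "\<lambda>i r. case i of 0 \<Rightarrow> f r | Suc j \<Rightarrow> (case j of 0 \<Rightarrow> g r | Suc l \<Rightarrow> \<sigma> l r)"] that
    by simp
  with Q(2) show thesis by (intro that) auto
qed

lemma davisI:
  assumes "dioph False (\<lambda>r. Q (r 0) (r 1) (\<lambda>i. r (Suc (Suc i))))" "\<And>r. R r \<longleftrightarrow> (\<exists>w. \<forall>k\<le>w. Q w k r)"
  shows "davis R"
  unfolding davis_def using assms by (intro exI[of _ Q] conjI allI)

lemma davis_dioph: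
  assumes "dioph False R"
  shows "davis R"
proof (rule davisI[where Q = "\<lambda>w k. R"])
  show "dioph False (\<lambda>r. R (\<lambda>i. r (Suc (Suc i))))"
    by (rule dioph_subst[OF assms]) auto
qed auto

lemma davis_subst:
  assumes "davis R" "\<And>i. poly_fun (\<sigma> i)"
  shows "davis (\<lambda>r. R (\<lambda>i. \<sigma> i r))"
proof (rule davisE[OF assms(1)])
  fix Q assume Q: "\<And>f g \<sigma>. poly_fun f \<Longrightarrow> poly_fun g \<Longrightarrow> (\<And>i. poly_fun (\<sigma> i)) \<Longrightarrow>
      dioph False (\<lambda>r. Q (f r) (g r) (\<lambda>i. \<sigma> i r))"
    "\<And>r. R r \<longleftrightarrow> (\<exists>w. \<forall>k\<le>w. Q w k r)"
  show ?thesis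
  proof (rule davisI[where Q = "\<lambda>w k r. Q w k (\<lambda>i. \<sigma> i r)"])
    show "dioph False (\<lambda>r. Q (r 0) (r 1) (\<lambda>i. \<sigma> i (\<lambda>i. r (Suc (Suc i)))))"
      by (intro Q(1) poly_fun_subst[OF assms(2)]) auto
  qed (simp add: Q(2))
qed

text \<open>The two bounds are paired into one number that is at least as large as either. The
  common variable \<open>k\<close> then overshoots each bound, and the guards \<open>u < k\<close>
  and \<open>v < k\<close> discard the excess.\<close>

lemma davis_conj [intro]:
  assumes "davis R" "davis S"
  shows "davis (\<lambda>r. R r \<and> S r)"
proof (rule davisE[OF assms(1)], rule davisE[OF assms(2)])
  fix Q P assume Q: "\<And>f g \<sigma>. poly_fun f \<Longrightarrow> poly_fun g \<Longrightarrow> (\<And>i. poly_fun (\<sigma> i)) \<Longrightarrow>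
      dioph False (\<lambda>r. Q (f r) (g r) (\<lambda>i. \<sigma> i r))"
    "\<And>r. R r \<longleftrightarrow> (\<exists>w. \<forall>k\<le>w. Q w k r)"
  assume P: "\<And>f g \<sigma>. poly_fun f \<Longrightarrow> poly_fun g \<Longrightarrow> (\<And>i. poly_fun (\<sigma> i)) \<Longrightarrow>
      dioph False (\<lambda>r. P (f r) (g r) (\<lambda>i. \<sigma> i r))"
    "\<And>r. S r \<longleftrightarrow> (\<exists>w. \<forall>k\<le>w. P w k r)"
  show ?thesis
  proof (rule davisI[where Q = "\<lambda>w k r. \<exists>u v. w = prod_encode (u, v) \<and> (u < k \<or> Q u k r) \<and> (v < k \<or> P v k r)"])
    show "dioph False (\<lambda>r. \<exists>u v. r 0 = prod_encode (u, v) \<and> (u < r 1 \<or> Q u (r 1) (\<lambda>i. r (Suc (Suc i)))) \<and>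
        (v < r 1 \<or> P v (r 1) (\<lambda>i. r (Suc (Suc i)))))"
      by (intro dioph_ex dioph_conj dioph_disj Q(1) P(1) dioph_fun_eq dioph_fun_less dioph_fun_prod_encode
          dioph_fun_poly poly_fun_var)
    fix r
    show "(R r \<and> S r) \<longleftrightarrow> (\<exists>w. \<forall>k\<le>w. \<exists>u v. w = prod_encode (u, v) \<and> (u < k \<or> Q u k r) \<and> (v < k \<or> P v k r))"
      (is "?l \<longleftrightarrow> ?r")
    proof
      assume ?l
      then obtain u v where uv: "\<forall>k\<le>u. Q u k r" "\<forall>k\<le>v. P v k r"
        unfolding Q P by blast
      show ?r
        by (rule exI[of _ "prod_encode (u, v)"], intro allI impI, rule exI[of _ u], rule exI[of _ v]) (use uv in \<open>meson linorder_not_less\<close>)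
    next
      assume ?r
      then obtain w where w: "\<And>k. k \<le> w \<Longrightarrow> \<exists>u v. w = prod_encode (u, v) \<and> (u < k \<or> Q u k r) \<and> (v < k \<or> P v k r)"
        by blast
      obtain u v where uv: "w = prod_encode (u, v)"
        using w[of 0] by blast
      have "u \<le> w" "v \<le> w"
        using uv le_prod_encode_1[of u v] le_prod_encode_2[of v u] by auto
      then have "Q u k r" if "k \<le> u" for k
        using w[of k] that by (auto simp: uv)
      moreover have "P v k r" if "k \<le> v" for k
        using w[of k] that \<open>v \<le> w\<close> by (auto simp: uv)
      ultimately show ?l
        unfolding Q P by blast
    qed
  qed
qed

text \<open>The witness is paired with the bound. A pair is at least its second component, so every
  \<open>k\<close> up to the bound is still examined; a guard discards the others.\<close>

lemma davis_ex [intro]: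
  assumes "davis (\<lambda>r. R (r 0) (\<lambda>i. r (Suc i)))"
  shows "davis (\<lambda>r. \<exists>x. R x r)"
proof (rule davisE[OF assms])
  fix Q assume Q: "\<And>f g \<sigma>. poly_fun f \<Longrightarrow> poly_fun g \<Longrightarrow> (\<And>i. poly_fun (\<sigma> i)) \<Longrightarrow>
      dioph False (\<lambda>r. Q (f r) (g r) (\<lambda>i. \<sigma> i r))"
    "\<And>r. R (r 0) (\<lambda>i. r (Suc i)) \<longleftrightarrow> (\<exists>w. \<forall>k\<le>w. Q w k r)"
  have R: "R x r \<longleftrightarrow> (\<exists>w. \<forall>k\<le>w. Q w k (\<lambda>i. case i of 0 \<Rightarrow> x | Suc j \<Rightarrow> r j))" for x r
    using Q(2)[of "\<lambda>i. case i of 0 \<Rightarrow> x | Suc j \<Rightarrow> r j"] by simp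
  let ?Q = "\<lambda>w k r. \<exists>x u. w = prod_encode (x, u) \<and> (u < k \<or> Q u k (\<lambda>i. case i of 0 \<Rightarrow> x | Suc j \<Rightarrow> r j))"
  show ?thesis
  proof (rule davisI[where Q = ?Q])
    show "dioph False (\<lambda>r. \<exists>x u. r 0 = prod_encode (x, u) \<and>
        (u < r 1 \<or> Q u (r 1) (\<lambda>i. case i of 0 \<Rightarrow> x | Suc j \<Rightarrow> r (Suc (Suc j)))))"
      by (intro dioph_ex dioph_conj dioph_disj Q(1) dioph_fun_eq dioph_fun_less dioph_fun_prod_encode
          dioph_fun_poly poly_fun_var poly_fun_case_nat)
    fix r
    show "(\<exists>x. R x r) \<longleftrightarrow> (\<exists>w. \<forall>k\<le>w. ?Q w k r)" (is "?l \<longleftrightarrow> ?r")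
    proof
      assume ?l
      then obtain x u where xu: "\<forall>k\<le>u. Q u k (\<lambda>i. case i of 0 \<Rightarrow> x | Suc j \<Rightarrow> r j)"
        unfolding R by blast
      show ?r
        by (rule exI[of _ "prod_encode (x, u)"], intro allI impI, rule exI[of _ x], rule exI[of _ u]) (use xu in \<open>meson linorder_not_less\<close>)
    next
      assume ?r
      then obtain w where w: "\<And>k. k \<le> w \<Longrightarrow> ?Q w k r" by blast
      obtain x u where xu: "w = prod_encode (x, u)"
        using w[of 0] by blast
      have "u \<le> w"
        using xu le_prod_encode_2[of u x] by auto
      then have "Q u k (\<lambda>i. case i of 0 \<Rightarrow> x | Suc j \<Rightarrow> r j)" if "k \<le> u" for k
        using w[of k] that by (auto simp: xu)
      then show ?l
        unfolding R by blast
    qed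
  qed
qed

text \<open>
  The witnesses for the inner existential quantifiers are collected by the beta function, and
  the two nested universal quantifiers become one over pairs.
\<close>

lemma davis_all_less:
  assumes "davis (\<lambda>r. R (r 0) (\<lambda>i. r (Suc i)))" "poly_fun n"
  shows "davis (\<lambda>r. \<forall>i<n r. R i r)"
proof (rule davisE[OF assms(1)])
  fix Q assume Q: "\<And>f g \<sigma>. poly_fun f \<Longrightarrow> poly_fun g \<Longrightarrow> (\<And>i. poly_fun (\<sigma> i)) \<Longrightarrow>
      dioph False (\<lambda>r. Q (f r) (g r) (\<lambda>i. \<sigma> i r))"
    "\<And>r. R (r 0) (\<lambda>i. r (Suc i)) \<longleftrightarrow> (\<exists>w. \<forall>k\<le>w. Q w k r)"
  have R: "R x r \<longleftrightarrow> (\<exists>w. \<forall>k\<le>w. Q w k (\<lambda>i. case i of 0 \<Rightarrow> x | Suc j \<Rightarrow> r j))" for x r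
    using Q(2)[of "\<lambda>i. case i of 0 \<Rightarrow> x | Suc j \<Rightarrow> r j"] by simp
  \<comment> \<open>\<open>T\<close> bounds all pairs that matter: the first condition admits
    \<open>(i, 0)\<close> for \<open>i < n r\<close>, and the instance at \<open>(i, 0)\<close> then
    admits \<open>(i, k)\<close> for every \<open>k\<close> up to the coded witness. Since
    \<open>T\<close> is a component of \<open>W\<close>, the codes of these pairs are at most
    \<open>W\<close>.\<close>
  let ?S = "\<lambda>A B T i k r. prod_encode (n r, 0) \<le> T \<and> (n r \<le> i \<or> (\<exists>w. w = beta A B i \<and> prod_encode (i, w) \<le> T \<and>
      (w < k \<or> Q w k (\<lambda>l. case l of 0 \<Rightarrow> i | Suc j \<Rightarrow> r j))))"
  let ?Q = "\<lambda>W j r. \<exists>A B T i k. W = prod_encode (A, prod_encode (B, T)) \<and> j = prod_encode (i, k) \<and> ?S A B T i k r"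
  show ?thesis
  proof (rule davisI[where Q = ?Q])
    show "dioph False (\<lambda>r. ?Q (r 0) (r 1) (\<lambda>i. r (Suc (Suc i))))"
      by (intro dioph_ex dioph_conj dioph_disj Q(1) dioph_fun_eq dioph_fun_less dioph_fun_le dioph_fun_prod_encode
          dioph_fun_beta dioph_fun_poly poly_fun_var poly_fun_const poly_fun_case_nat poly_fun_subst[OF assms(2)])
    fix r
    show "(\<forall>i<n r. R i r) \<longleftrightarrow> (\<exists>w. \<forall>k\<le>w. ?Q w k r)" (is "?l \<longleftrightarrow> ?r")
    proof
      assume ?l
      then obtain ws where ws: "\<And>i k. i < n r \<Longrightarrow> k \<le> ws i \<Longrightarrow> Q (ws i) k (\<lambda>l. case l of 0 \<Rightarrow> i | Suc j \<Rightarrow> r j)"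
        unfolding R by metis
      obtain A B where AB: "\<And>i. i < n r \<Longrightarrow> beta A B i = ws i"
        using ex_beta by blast
      define T where "T = prod_encode (n r, 0) + (\<Sum>i<n r. prod_encode (i, ws i))"
      have T: "prod_encode (i, ws i) \<le> T" if "i < n r" for i
        using that member_le_sum[of i "{..<n r}" "\<lambda>i. prod_encode (i, ws i)"] by (simp add: T_def)
      have "?S A B T i k r" for i k
        using ws[of i k] AB[of i] T[of i] by (cases "i < n r"; cases "k \<le> ws i") (auto simp: T_def)
      then have "?Q (prod_encode (A, prod_encode (B, T))) j r" for j
        by (metis prod_decode_inverse surj_pair)
      then show ?r by blast
    next
      assume ?r
      then obtain W where W: "\<And>j. j \<le> W \<Longrightarrow> ?Q W j r" by blast
      obtain A B T where ABT: "W = prod_encode (A, prod_encode (B, T))" and T: "prod_encode (n r, 0) \<le> T"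
        using W[of 0] by blast
      have TW: "T \<le> W"
        using ABT le_prod_encode_2 order_trans by metis
      have S: "?S A B T i k r" if "prod_encode (i, k) \<le> T" for i k
      proof -
        have "prod_encode (i, k) \<le> W" using that TW by simp
        from W[OF this] show ?thesis by (simp only: ABT prod_encode_eq) auto
      qed
      show ?l
      proof (intro allI impI)
        fix i assume i: "i < n r"
        have "prod_encode (i, 0) \<le> T"
          using T i prod_encode_mono[of i "n r" 0 0] by simp
        from S[OF this] i have *: "prod_encode (i, beta A B i) \<le> T" by simp
        have "Q (beta A B i) k (\<lambda>l. case l of 0 \<Rightarrow> i | Suc j \<Rightarrow> r j)" if "k \<le> beta A B i" for k
          using S[of i k] prod_encode_mono[of i i k "beta A B i"] that * i by simp
        then show "R i r" unfolding R by blast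
      qed
    qed
  qed
qed

lemma davis_all_fin:
  assumes "\<And>j. j < (n::nat) \<Longrightarrow> davis (R j)"
  shows "davis (\<lambda>r. \<forall>j<n. R j r)"
  using assms
proof (induction n)
  case 0
  then show ?case by (auto intro: davis_dioph)
next
  case (Suc n)
  then have "davis (\<lambda>r. (\<forall>j<n. R j r) \<and> R n r)" by auto
  then show ?case by (simp add: All_less_Suc conj_commute)
qed

text \<open>The length is fixed, so only \<open>m\<close> quantifiers arise; this serves the
  intermediate results of \<open>Comp\<close>.\<close>

lemma davis_ex_list:
  assumes "davis (\<lambda>r. R (map r [0..<m]) (\<lambda>i. r (m + i)))"
  shows "davis (\<lambda>r. \<exists>ys. length ys = m \<and> R ys r)"
  using assms
proof (induction m arbitrary: R)
  case 0
  then show ?case by simp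
next
  case (Suc m)
  have "davis (\<lambda>r. \<exists>ys. length ys = m \<and> R (r 0 # ys) (\<lambda>i. r (Suc i)))"
  proof (rule Suc.IH)
    \<comment> \<open>The head is bound before the other \<open>m\<close> entries and hence sits at
      position \<open>m\<close>; the substitution rotates it to the front.\<close>
    let ?\<sigma> = "\<lambda>i r. if i = 0 then r m else if i \<le> m then r (i - 1) else r i"
    have "davis (\<lambda>r. R (map (\<lambda>i. ?\<sigma> i r) [0..<Suc m]) (\<lambda>i. ?\<sigma> (Suc m + i) r))"
      by (rule davis_subst[OF Suc.prems]) (intro poly_fun_if poly_fun_var)
    moreover have "map (\<lambda>i. ?\<sigma> i r) [0..<Suc m] = r m # map r [0..<m]" for r :: "nat \<Rightarrow> nat"
      by (rule nth_equalityI) (auto simp: nth_Cons simp del: upt_Suc split: nat.split)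
    ultimately show "davis (\<lambda>r. R (r (m + 0) # map r [0..<m]) (\<lambda>i. r (m + Suc i)))" by simp
  qed
  then have "davis (\<lambda>r. \<exists>x ys. length ys = m \<and> R (x # ys) r)" by (rule davis_ex)
  moreover have "(\<exists>ys. length ys = Suc m \<and> R ys r) \<longleftrightarrow> (\<exists>x ys. length ys = m \<and> R (x # ys) r)" for r
    by (metis length_Suc_conv)
  ultimately show ?case by simp
qed

section \<open>The graphs of programs\<close>

lemma computes_Zero_iff: "computes Zero xs y \<longleftrightarrow> y = 0"
  by (auto elim: computes.cases intro: computes.intros)

lemma computes_Succ_iff: "computes Succ xs y \<longleftrightarrow> (\<exists>x. xs = [x] \<and> y = Suc x)"
  by (auto elim: computes.cases intro: computes.intros)

lemma computes_Proj_iff: "computes (Proj i) xs y \<longleftrightarrow> i < length xs \<and> y = xs ! i"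
  by (auto elim: computes.cases intro: computes.intros)

lemma computes_Comp_iff:
  "computes (Comp f gs) xs z \<longleftrightarrow>
    (\<exists>ys. length ys = length gs \<and> (\<forall>j<length gs. computes (gs ! j) xs (ys ! j)) \<and> computes f ys z)"
proof -
  have "computes (Comp f gs) xs z \<longleftrightarrow> (\<exists>ys. list_all2 (\<lambda>g y. computes g xs y) gs ys \<and> computes f ys z)"
    by (auto elim: computes.cases intro: computes.Comp)
  then show ?thesis
    unfolding list_all2_conv_all_nth by metis
qed

lemma computes_PrimRec_Nil: "\<not> computes (PrimRec f g) [] y"
  by (auto elim: computes.cases)

text \<open>The recursion is replaced by its whole sequence of values, the form that
  \<open>beta\<close> can code.\<close>

lemma computes_PrimRec_iff:
  "computes (PrimRec f g) (n # xs) y \<longleftrightarrow>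
    (\<exists>s. computes f xs (s 0) \<and> (\<forall>i<n. computes g (i # s i # xs) (s (Suc i))) \<and> y = s n)"
proof (induction n arbitrary: y)
  case 0
  have "computes (PrimRec f g) (0 # xs) y \<longleftrightarrow> computes f xs y"
    by (auto elim: computes.cases intro: computes.intros)
  then show ?case by auto
next
  case (Suc n)
  have "computes (PrimRec f g) (Suc n # xs) y \<longleftrightarrow>
      (\<exists>r. computes (PrimRec f g) (n # xs) r \<and> computes g (n # r # xs) y)"
    by (auto elim: computes.cases intro: computes.intros)
  also have "\<dots> \<longleftrightarrow> (\<exists>s. computes f xs (s 0) \<and> (\<forall>i<Suc n. computes g (i # s i # xs) (s (Suc i))) \<and> y = s (Suc n))"
    (is "?l \<longleftrightarrow> ?r")
  proof
    assume ?l
    then obtain s where s: "computes f xs (s 0)" "\<forall>i<n. computes g (i # s i # xs) (s (Suc i))"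
      "computes g (n # s n # xs) y"
      unfolding Suc.IH by blast
    then show ?r
      by (intro exI[of _ "s(Suc n := y)"]) (auto simp: less_Suc_eq)
  next
    assume ?r
    then obtain s where s: "computes f xs (s 0)" "\<forall>i<Suc n. computes g (i # s i # xs) (s (Suc i))" "y = s (Suc n)"
      by blast
    then show ?l unfolding Suc.IH by (intro exI[of _ "s n"]) auto
  qed
  finally show ?case .
qed

lemma computes_Mu_iff:
  "computes (Mu f) xs n \<longleftrightarrow> computes f (n # xs) 0 \<and> (\<forall>i<n. \<exists>y. computes f (i # xs) (Suc y))"
  by (auto elim: computes.cases intro: computes.intros)

text \<open>By induction on the program, for any number of arguments: \<open>Comp\<close> guesses
  the intermediate results, \<open>PrimRec\<close> guesses a code of the value sequence and checks
  each step under a bounded quantifier, and \<open>Mu\<close> checks each smaller argument in the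
  same way.\<close>

lemma davis_computes:
  "davis (\<lambda>r. computes f (map (\<lambda>i. r (Suc i)) [0..<n]) (r 0))"
proof -
  have inst: "davis (\<lambda>r. computes g (map (\<lambda>i. \<sigma> i r) [0..<m]) (\<tau> r))"
    if "davis (\<lambda>r. computes g (map (\<lambda>i. r (Suc i)) [0..<m]) (r 0))"
      "\<And>i. poly_fun (\<sigma> i)" "poly_fun \<tau>" for g m \<sigma> \<tau>
    using davis_subst[OF that(1), of "\<lambda>i r. case i of 0 \<Rightarrow> \<tau> r | Suc j \<Rightarrow> \<sigma> j r"] that by simp
  show ?thesis
  proof (induction f arbitrary: n)
    case Zero
    then show ?case by (auto simp: computes_Zero_iff intro: davis_dioph)
  next
    case Succ
    show ?case
    proof (cases "n = 1")
      case True
      then show ?thesis by (auto simp: computes_Succ_iff intro!: davis_dioph dioph_eq)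
    next
      case False
      then have "\<not> computes Succ (map (\<lambda>i. r (Suc i)) [0..<n]) (r 0)" for r
        by (auto simp: computes_Succ_iff dest: arg_cong[of _ _ length])
      \<comment> \<open>An unsatisfiable relation stands for a wrong number of arguments.\<close>
      moreover have "davis (\<lambda>r. 0 = (1::nat))" by (intro davis_dioph dioph_eq) auto
      ultimately show ?thesis by simp
    qed
  next
    case (Proj i)
    show ?case
    proof (cases "i < n")
      case True
      then show ?thesis by (auto simp: computes_Proj_iff intro!: davis_dioph dioph_eq)
    next
      case False
      moreover have "davis (\<lambda>r. 0 = (1::nat))" by (intro davis_dioph dioph_eq) auto
      ultimately show ?thesis by (simp add: computes_Proj_iff)
    qed
  next
    case (Comp f gs)
    let ?m = "length gs"
    show ?case unfolding computes_Comp_iff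
    proof (intro davis_ex_list davis_conj davis_all_fin)
      fix j assume j: "j < ?m"
      have "davis (\<lambda>r. computes (gs ! j) (map (\<lambda>i. r (?m + Suc i)) [0..<n]) (r j))"
        by (rule inst[OF Comp.IH(2)]) (use j in auto)
      then show "davis (\<lambda>r. computes (gs ! j) (map (\<lambda>i. r (?m + Suc i)) [0..<n]) (map r [0..<?m] ! j))"
        using j by simp
    next
      show "davis (\<lambda>r. computes f (map r [0..<?m]) (r (?m + 0)))"
        by (rule inst[OF Comp.IH(1)]) auto
    qed
  next
    case (PrimRec f g)
    show ?case
    proof (cases n)
      case 0
      moreover have "davis (\<lambda>r. 0 = (1::nat))" by (intro davis_dioph dioph_eq) auto
      ultimately show ?thesis by (simp add: computes_PrimRec_Nil)
    next
      case (Suc m)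
      let ?xs = "\<lambda>r. map (\<lambda>i. r (Suc (Suc i))) [0..<m]"
      have eq: "computes (PrimRec f g) (map (\<lambda>i. r (Suc i)) [0..<n]) (r 0) \<longleftrightarrow>
        (\<exists>A B. (\<exists>z. z = beta A B 0 \<and> computes f (?xs r) z) \<and>
          (\<forall>i<r 1. \<exists>u v. u = beta A B i \<and> v = beta A B (Suc i) \<and> computes g (i # u # ?xs r) v) \<and>
          r 0 = beta A B (r 1))" (is "?l \<longleftrightarrow> ?r") for r
      proof -
        have "map (\<lambda>i. r (Suc i)) [0..<n] = r 1 # ?xs r"
          using Suc by (simp add: map_upt_Suc del: upt_Suc)
        then have l: "?l \<longleftrightarrow> (\<exists>s. computes f (?xs r) (s 0) \<and>
            (\<forall>i<r 1. computes g (i # s i # ?xs r) (s (Suc i))) \<and> r 0 = s (r 1))"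
          by (simp add: computes_PrimRec_iff)
        show ?thesis
        proof
          assume ?l
          then obtain s where s: "computes f (?xs r) (s 0)"
            "\<And>i. i < r 1 \<Longrightarrow> computes g (i # s i # ?xs r) (s (Suc i))" "r 0 = s (r 1)"
            unfolding l by blast
          obtain A B where "\<forall>i<Suc (r 1). beta A B i = s i"
            using ex_beta by blast
          then have AB: "beta A B i = s i" if "i \<le> r 1" for i
            using that by simp
          show ?r
            by (rule exI[of _ A], rule exI[of _ B]) (use s AB in \<open>auto simp: Suc_le_eq\<close>)
        next
          assume ?r
          then obtain A B where "computes f (?xs r) (beta A B 0)"
            "\<And>i. i < r 1 \<Longrightarrow> computes g (i # beta A B i # ?xs r) (beta A B (Suc i))" "r 0 = beta A B (r 1)"
            by blast
          then show ?l unfolding l by (intro exI[of _ "beta A B"]) auto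
        qed
      qed
      \<comment> \<open>The arguments \<open>?xs\<close> start at position 2. Binding
        \<open>A\<close>, \<open>B\<close>, \<open>z\<close> shifts them by 3, and binding
        \<open>A\<close>, \<open>B\<close>, \<open>i\<close>, \<open>u\<close>, \<open>v\<close>
        shifts them by 5.\<close>
      have f: "davis (\<lambda>r. computes f (map (\<lambda>i. r (i + 5)) [0..<m]) (r 0))"
        by (rule inst[OF PrimRec.IH(1)]) auto
      have "davis (\<lambda>r. computes g (map (\<lambda>i. (case i of 0 \<Rightarrow> r 2 | Suc j \<Rightarrow> case j of 0 \<Rightarrow> r 1 | Suc l \<Rightarrow> r (l + 7))) [0..<Suc (Suc m)]) (r 0))"
        by (rule inst[OF PrimRec.IH(2)]) auto
      then have g: "davis (\<lambda>r. computes g (r 2 # r 1 # map (\<lambda>i. r (i + 7)) [0..<m]) (r 0))"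
        by (simp add: map_upt_Suc del: upt_Suc)
      show ?thesis unfolding eq
        using f g
        by (intro davis_ex davis_conj davis_all_less davis_dioph[OF dioph_fun_eq] dioph_fun_beta dioph_fun_poly
            poly_fun_Suc poly_fun_var poly_fun_const) (simp_all add: numeral_eq_Suc)
    qed
  next
    case (Mu f)
    have f: "davis (\<lambda>r. computes f (map (\<lambda>i. (case i of 0 \<Rightarrow> r 0 | Suc j \<Rightarrow> r (Suc j))) [0..<Suc n]) 0)"
      by (rule inst[OF Mu.IH]) auto
    have "davis (\<lambda>r. computes f (map (\<lambda>i. (case i of 0 \<Rightarrow> r 1 | Suc j \<Rightarrow> r (j + 3))) [0..<Suc n]) (Suc (r 0)))"
      by (rule inst[OF Mu.IH]) auto
    then have g: "davis (\<lambda>r. computes f (r 1 # map (\<lambda>i. r (i + 3)) [0..<n]) (Suc (r 0)))"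
      by (simp add: map_upt_Suc del: upt_Suc)
    show ?case unfolding computes_Mu_iff
      using f g by (intro davis_conj davis_all_less davis_ex)
        (simp_all add: map_upt_Suc numeral_eq_Suc del: upt_Suc)
  qed
qed

section \<open>Elimination of the bounded quantifier\<close>

text \<open>Powers of two determine all powers: modulo \<open>2 ^ B - x\<close> the number
  \<open>2 ^ B\<close> is congruent to \<open>x\<close>, hence \<open>(2 ^ B) ^ n\<close> to
  \<open>x ^ n\<close>, and \<open>B\<close> is so large that \<open>x ^ n\<close> is the remainder
  itself.\<close>

lemma power_eq_pow2_mod:
  fixes x n :: nat
  defines "B \<equiv> x * n + x + 1"
  shows "x ^ n = 2 ^ (B * n) mod (2 ^ B - x)" "x < 2 ^ B"
proof -
  have x: "x < 2 ^ x" by simp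
  have "x ^ n + x < 2 ^ (x * n) + 2 ^ x"
    using power_mono[of x "2 ^ x" n] x by (intro add_le_less_mono) (auto simp: power_mult)
  also have "\<dots> \<le> 2 ^ (x * n + x) + 2 ^ (x * n + x)"
    by (intro add_mono power_increasing) auto
  also have "\<dots> = 2 ^ B" by (simp add: B_def)
  finally have *: "x ^ n + x < 2 ^ B" .
  then show "x < 2 ^ B" by simp
  then have "2 ^ B = (2 ^ B - x) + x" by simp
  then have "[2 ^ B = x] (mod (2 ^ B - x))"
    by (metis cong_add_lcancel_0_nat cong_def mod_add_self1)
  then have "[(2 ^ B) ^ n = x ^ n] (mod (2 ^ B - x))"
    by (rule cong_pow)
  moreover have "x ^ n < 2 ^ B - x"
    using * by simp
  ultimately show "x ^ n = 2 ^ (B * n) mod (2 ^ B - x)"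
    by (simp add: cong_def power_mult)
qed

lemma dioph_fun_power [intro]:
  assumes "dioph_fun True f" "dioph_fun True g"
  shows "dioph_fun True (\<lambda>r. f r ^ g r)"
proof -
  let ?B = "\<lambda>r. f r * g r + f r + 1"
  have "dioph_fun True (\<lambda>r. 2 ^ (?B r * g r) mod (2 ^ ?B r - f r))"
    using assms power_eq_pow2_mod(2)
    by (intro dioph_fun_mod dioph_fun_diff dioph_fun_pow2 dioph_fun_mult dioph_fun_add dioph_fun_poly[OF poly_fun_const])
      (auto simp: less_imp_le)
  then show ?thesis by (simp only: power_eq_pow2_mod(1)[symmetric])
qed

lemma digit_of_sum:
  fixes c :: "nat \<Rightarrow> nat"
  assumes "\<And>i. c i < b"
  shows "(\<Sum>i<n. c i * b ^ i) div b ^ k mod b = (if k < n then c k else 0)"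
  using assms
proof (induction k arbitrary: c n)
  case 0
  show ?case
  proof (cases n)
    case (Suc m)
    have "(\<Sum>i<n. c i * b ^ i) = c 0 + b * (\<Sum>i<m. c (Suc i) * b ^ i)"
      unfolding Suc sum.lessThan_Suc_shift by (simp add: sum_distrib_left mult_ac)
    then show ?thesis using 0 Suc by simp
  qed simp
next
  case (Suc k)
  show ?case
  proof (cases n)
    case (Suc m)
    have "(\<Sum>i<n. c i * b ^ i) = c 0 + b * (\<Sum>i<m. c (Suc i) * b ^ i)"
      unfolding Suc sum.lessThan_Suc_shift by (simp add: sum_distrib_left mult_ac)
    also have "\<dots> div b = (\<Sum>i<m. c (Suc i) * b ^ i)"
      using Suc.prems[of 0] by simp
    finally have "(\<Sum>i<n. c i * b ^ i) div b ^ Suc k = (\<Sum>i<m. c (Suc i) * b ^ i) div b ^ k"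
      by (simp add: div_mult2_eq)
    then show ?thesis
      using Suc.IH[of "\<lambda>i. c (Suc i)" m] Suc.prems Suc by simp
  qed simp
qed

text \<open>By the binomial theorem the coefficients are the digits of \<open>(1 + b) ^ n\<close> in
  base \<open>b = 2 ^ Suc n\<close>, which exceeds all of them.\<close>

lemma binomial_eq_digit: "n choose k = (1 + 2 ^ Suc n) ^ n div 2 ^ (Suc n * k) mod 2 ^ Suc n"
proof -
  let ?b = "2 ^ Suc n :: nat"
  have less: "n choose i < ?b" for i
    using binomial_le_pow2[of n i] by (rule le_less_trans) simp
  have "(1 + ?b) ^ n = (\<Sum>i\<le>n. (n choose i) * ?b ^ i)"
    using binomial_ring[of ?b 1 n] by (simp add: add.commute)
  also have "\<dots> = (\<Sum>i<Suc n. (n choose i) * ?b ^ i)"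
    by (simp only: lessThan_Suc_atMost)
  finally have "(1 + ?b) ^ n div ?b ^ k mod ?b = (if k < Suc n then n choose k else 0)"
    using digit_of_sum[of "\<lambda>i. n choose i" ?b "Suc n" k, OF less] by simp
  then have "(1 + ?b) ^ n div 2 ^ (Suc n * k) mod ?b = (if k < Suc n then n choose k else 0)"
    by (simp only: power_mult)
  then show ?thesis by simp
qed

lemma dioph_fun_binomial [intro]:
  assumes "dioph_fun True f" "dioph_fun True g"
  shows "dioph_fun True (\<lambda>r. f r choose g r)"
  unfolding binomial_eq_digit using assms
  by (intro dioph_fun_mod dioph_fun_div dioph_fun_power dioph_fun_pow2 dioph_fun_mult dioph_fun_add dioph_fun_Suc
     dioph_fun_poly[OF poly_fun_const]) auto

text \<open>The falling factorial. Over the integers the identity also covers \<open>a < n\<close>,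
  where the factor for \<open>i = a\<close> is zero. It serves the factorial below and later the
  bounds on witnesses.\<close>

lemma prod_diff_eq_fact_binomial: "(\<Prod>i<n. int a - int i) = fact n * int (a choose n)"
proof -
  have "real_of_int (\<Prod>i<n. int a - int i) = (\<Prod>i = 0..<n. real a - real i)"
    by (simp add: atLeast0LessThan)
  also have "\<dots> = fact n * real (a choose n)"
    by (simp add: gbinomial_mult_fact[symmetric] binomial_gbinomial)
  also have "\<dots> = real_of_int (fact n * int (a choose n))" by simp
  finally show ?thesis by (simp only: of_int_eq_iff)
qed

text \<open>For growing \<open>r\<close> the quotient of \<open>r ^ n\<close> by
  \<open>r choose n\<close> tends to \<open>n!\<close> from above, because the falling factorial of
  \<open>r\<close> is at least \<open>r ^ n * (1 - n^2 / r)\<close>. The chosen \<open>r\<close>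
  exceeds \<open>(n! + 1) * n^2\<close>, as \<open>n!\<close> is at most \<open>n ^ n\<close>, and
  this brings the quotient below \<open>n! + 1\<close>.\<close>

lemma fact_eq_div_binomial:
  fixes n :: nat
  defines "r \<equiv> (n ^ n + 1) * n\<^sup>2 + n + 1"
  shows "fact n = r ^ n div (r choose n)"
proof -
  have rn: "k < r" if "k \<le> n" for k using that by (simp add: r_def)
  define P where "P = (\<lambda>n. \<Prod>i<n. int r - int i)"
  have le: "P k \<le> int r ^ k" if "k \<le> n" for k
  proof -
    have "P k \<le> (\<Prod>i<k. int r)"
      unfolding P_def using rn that by (intro prod_mono) (auto simp: less_imp_le order.strict_trans2)
    then show ?thesis by simp
  qed
  \<comment> \<open>An inequality of Bernoulli type, multiplied by \<open>r\<close> to stay in the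
    integers.\<close>
  have ge: "int r ^ k * (int r - (int k)\<^sup>2) \<le> P k * int r" if "k \<le> n" for k
    using that
  proof (induction k)
    case 0
    then show ?case by (simp add: P_def)
  next
    case (Suc k)
    let ?r = "int r" and ?k = "int k"
    have kr: "?k \<le> ?r" using rn[of k] Suc.prems by simp
    have "?r ^ Suc k * (?r - (int (Suc k))\<^sup>2) \<le> ?r ^ k * ((?r - ?k\<^sup>2) * (?r - ?k))"
    proof -
      have "?r * (?r - (int (Suc k))\<^sup>2) = ?r * ?r - ?r * ?k\<^sup>2 - 2 * ?r * ?k - ?r"
        by (simp add: power2_eq_square algebra_simps)
      also have "\<dots> \<le> ?r * ?r - ?r * ?k\<^sup>2 - ?r * ?k + ?k\<^sup>2 * ?k"
        by (simp add: algebra_simps)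
      also have "\<dots> = (?r - ?k\<^sup>2) * (?r - ?k)"
        by (simp add: power2_eq_square algebra_simps)
      finally have "?r * (?r - (int (Suc k))\<^sup>2) \<le> (?r - ?k\<^sup>2) * (?r - ?k)" .
      then have "?r ^ k * (?r * (?r - (int (Suc k))\<^sup>2)) \<le> ?r ^ k * ((?r - ?k\<^sup>2) * (?r - ?k))"
        by (intro mult_left_mono) auto
      then show ?thesis by (simp only: power_Suc mult_ac)
    qed
    also have "\<dots> = (?r ^ k * (?r - ?k\<^sup>2)) * (?r - ?k)" by simp
    also have "\<dots> \<le> (P k * ?r) * (?r - ?k)"
      using Suc kr by (intro mult_right_mono) auto
    also have "\<dots> = P (Suc k) * ?r" by (simp add: P_def)
    finally show ?case .
  qed
  have P: "P n = fact n * int (r choose n)"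
    unfolding P_def by (rule prod_diff_eq_fact_binomial)
  have "int (fact n * (r choose n)) \<le> int (r ^ n)"
    using le[of n] P by simp
  then have 1: "fact n * (r choose n) \<le> r ^ n" by (simp only: of_nat_le_iff)
  let ?F = "fact n :: int"
  have F: "?F \<le> int (n ^ n)"
    using fact_le_power[of n, where 'a = int] by simp
  have r: "int r = (int (n ^ n) + 1) * (int n)\<^sup>2 + int n + 1"
    by (simp add: r_def algebra_simps)
  have "(?F + 1) * (int n)\<^sup>2 \<le> (int (n ^ n) + 1) * (int n)\<^sup>2"
    using F by (intro mult_right_mono) auto
  then have "(?F + 1) * (int n)\<^sup>2 < int r"
    unfolding r by linarith
  then have "?F * int r < (?F + 1) * (int r - (int n)\<^sup>2)"
    by (simp add: algebra_simps)
  then have "int r ^ n * (?F * int r) < int r ^ n * ((?F + 1) * (int r - (int n)\<^sup>2))"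
    using rn[of n] by (intro mult_strict_left_mono) auto
  also have "\<dots> = (?F + 1) * (int r ^ n * (int r - (int n)\<^sup>2))" by (simp only: mult_ac)
  also have "\<dots> \<le> (?F + 1) * (P n * int r)"
    using ge[of n] by (intro mult_left_mono) auto
  finally have "(?F * int r) * int r ^ n < (?F * int r) * ((?F + 1) * int (r choose n))"
    unfolding P by (simp only: mult_ac)
  then have "int r ^ n < (?F + 1) * int (r choose n)"
    by (rule mult_left_less_imp_less) auto
  also have "\<dots> = int (Suc (fact n) * (r choose n))" by (simp add: algebra_simps)
  finally have "r ^ n < Suc (fact n) * (r choose n)"
    by (metis of_nat_less_iff of_nat_power)
  with 1 show ?thesis
    by (intro div_nat_eqI[symmetric]) (auto simp: mult_ac)
qed

lemma dioph_fun_fact [intro]: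
  assumes "dioph_fun True f"
  shows "dioph_fun True (\<lambda>r. fact (f r))"
  unfolding fact_eq_div_binomial using assms
  by (intro dioph_fun_div dioph_fun_power dioph_fun_binomial dioph_fun_mult dioph_fun_add dioph_fun_poly[OF poly_fun_const])
    auto

section \<open>A bounded quantifier as a divisibility condition\<close>

lemma prod_dvd_if_coprime:
  fixes m :: "'b \<Rightarrow> 'a :: {unique_euclidean_ring, semiring_gcd}"
  assumes "\<And>i. i \<in> A \<Longrightarrow> m i dvd x" "\<And>i j. i \<in> A \<Longrightarrow> j \<in> A \<Longrightarrow> i \<noteq> j \<Longrightarrow> coprime (m i) (m j)"
  shows "prod m A dvd x"
  using cong_cong_prod_coprime[of A x 0 m] assms by (simp add: cong_0_iff)

text \<open>Each factor \<open>s + i\<close> of the rising product is \<open>i\<close> times a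
  modulus, and the factors \<open>i\<close> cancel against \<open>fact N\<close>. Thus a product
  with a variable number of factors becomes existentially definable.\<close>

lemma binomial_eq_prod:
  assumes "\<And>i. i \<in> {1..N} \<Longrightarrow> i dvd s"
  shows "(s + N) choose N = (\<Prod>i = 1..N. 1 + s div i)"
proof -
  have "(\<Prod>i = 1..n. s + i) * fact s = (fact (s + n) :: nat)" for n
    by (induction n) (auto simp: algebra_simps)
  moreover have "fact N * ((s + N) choose N) * fact s = (fact (s + N) :: nat)"
    using binomial_fact_lemma[of N "s + N"] by (simp add: mult_ac)
  ultimately have "fact N * ((s + N) choose N) * fact s = (\<Prod>i = 1..N. s + i) * fact s" by simp
  then have "fact N * ((s + N) choose N) = (\<Prod>i = 1..N. s + i)" by simp
  also have "\<dots> = (\<Prod>i = 1..N. i * (1 + s div i))"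
    using assms by (intro prod.cong) (auto simp: algebra_simps)
  also have "\<dots> = fact N * (\<Prod>i = 1..N. 1 + s div i)"
    by (simp only: prod.distrib fact_prod of_nat_id)
  finally show ?thesis by simp
qed

text \<open>
  The factors \<open>1 + s div i\<close> of \<open>s + N choose N\<close> serve as the moduli of a simultaneous congruence.
  They are coprime and \<open>- s\<close> is congruent to \<open>i\<close> modulo the \<open>i\<close>-th one, so that
  \<open>P (- s - 1)\<close> stands for the values \<open>P 0, \<dots>, P w\<close> at once.
\<close>

locale moduli =
  fixes G N s :: nat
  assumes N: "N \<le> G" and s: "s = (fact G)\<^sup>2"
begin

definition md :: "nat \<Rightarrow> nat" where "md i = 1 + s div i"

lemma dvd_s: "d \<ge> 1 \<Longrightarrow> d \<le> G \<Longrightarrow> d dvd s"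
  unfolding s power2_eq_square by (intro dvd_mult dvd_fact) auto

text \<open>The reason for the square in \<open>s\<close>: one copy of \<open>fact G\<close>
  survives the division by \<open>i\<close>.\<close>

lemma fact_dvd_s_div:
  assumes "i \<in> {1..N}" shows "fact G dvd s div i"
proof -
  have "i dvd fact G" using assms N by (intro dvd_fact) auto
  then have "s div i = fact G * (fact G div i)"
    by (simp add: s power2_eq_square div_mult_swap)
  then show ?thesis by simp
qed

text \<open>A divisor up to \<open>G\<close> divides \<open>fact G\<close>, so it divides
  \<open>s div i\<close> and what remains, namely 1. Hence the prime factors of the moduli exceed
  every bound built into \<open>G\<close>.\<close>

lemma dvd_md_imp:
  assumes "i \<in> {1..N}" "d dvd md i" "d \<le> G" shows "d = 1"
proof -
  have "d > 0" using assms(2) by (intro gr0I) (auto simp: md_def)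
  then have "d dvd fact G" using assms(3) by (intro dvd_fact) auto
  then have "d dvd s div i" using fact_dvd_s_div[OF assms(1)] by (rule dvd_trans)
  then show ?thesis using assms(2) dvd_add_left_iff[of d "s div i" 1] by (simp add: md_def)
qed

lemma mult_md: "i \<in> {1..N} \<Longrightarrow> i * md i = s + i"
  using dvd_s[of i] N by (auto simp: md_def algebra_simps)

lemma coprime_md_less:
  assumes "i \<in> {1..N}" "j \<in> {1..N}" "i < j" shows "coprime (md i) (md j)"
proof (rule coprimeI)
  fix c assume c: "c dvd md i" "c dvd md j"
  have "j * md j = i * md i + (j - i)"
    using assms by (simp add: mult_md)
  then have "c dvd j - i"
    using c by (metis dvd_add_right_iff dvd_mult)
  then have "c \<le> G"
    using assms N by (auto dest!: dvd_imp_le)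
  then show "is_unit c"
    using dvd_md_imp[OF assms(1) c(1)] by simp
qed

lemma coprime_md: "i \<in> {1..N} \<Longrightarrow> j \<in> {1..N} \<Longrightarrow> i \<noteq> j \<Longrightarrow> coprime (md i) (md j)"
  using coprime_md_less by (metis coprime_commute linorder_neqE_nat)

lemma binomial_eq_prod_md: "(s + N) choose N = prod md {1..N}"
  unfolding md_def using N dvd_s by (intro binomial_eq_prod) auto

lemma coprime_md_fact:
  assumes "i \<in> {1..N}" shows "coprime (md i) (fact G)"
proof (rule coprimeI)
  fix c assume c: "c dvd md i" "c dvd fact G"
  then have "c dvd s div i" using fact_dvd_s_div[OF assms(1)] dvd_trans by blast
  then show "is_unit c"
    using c(1) dvd_add_left_iff[of c "s div i" 1] by (simp add: md_def)
qed

lemma cong_uminus_s: "i \<in> {1..N} \<Longrightarrow> [- int s - 1 = int i - 1] (mod int (md i))"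
proof -
  assume "i \<in> {1..N}"
  from mult_md[OF this] have "int s + int i = int i * int (md i)"
    by (metis of_nat_add of_nat_mult)
  then have "(int i - 1) - (- int s - 1) = int i * int (md i)" by simp
  then have "int (md i) dvd (int i - 1) - (- int s - 1)" by simp
  then show ?thesis by (simp add: cong_iff_dvd_diff dvd_diff_commute)
qed

end

text \<open>One prime factor \<open>q\<close> of the modulus for \<open>k\<close> suffices. As
  \<open>q\<close> divides the falling factorial of \<open>A v\<close>, it divides a single factor,
  so the residue of \<open>A v\<close> is at most \<open>u\<close>. At these residues
  \<open>P\<close> is divisible by \<open>q\<close> but smaller than \<open>q\<close> in absolute
  value, and therefore zero.\<close>

lemma bounded_quantifier_sound:
  fixes P :: "int \<Rightarrow> (nat \<Rightarrow> int) \<Rightarrow> int"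
  assumes cong: "\<And>k k' z z' m. [k = k'] (mod m) \<Longrightarrow> (\<And>v. v < V \<Longrightarrow> [z v = z' v] (mod m)) \<Longrightarrow> [P k z = P k' z'] (mod m)"
    and bound: "\<And>z. (\<And>v. v < V \<Longrightarrow> z v \<le> u) \<Longrightarrow> \<bar>P (int k) (\<lambda>v. int (z v))\<bar> \<le> int b"
    and k: "k \<le> w"
    and s: "s = (fact (b + w + u + 2))\<^sup>2"
    and dvd: "int ((s + Suc w) choose Suc w) dvd P (- int s - 1) (\<lambda>v. int (A v))"
      "\<And>v. v < V \<Longrightarrow> (s + Suc w) choose Suc w dvd A v choose Suc u"
  shows "\<exists>z. P (int k) (\<lambda>v. int (z v)) = 0"
proof -
  define G where "G = b + w + u + 2"
  interpret moduli G "Suc w" s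
    by unfold_locales (auto simp: G_def s)
  \<comment> \<open>Moduli are numbered from 1: modulo the one for \<open>Suc k\<close>, the
    argument \<open>- s - 1\<close> is congruent to \<open>k\<close>.\<close>
  define i where "i = Suc k"
  have i: "i \<in> {1..Suc w}" using k by (auto simp: i_def)
  have "i dvd s" "s > 0"
    using dvd_s[of i] i by (auto simp: G_def s)
  then have "s div i > 0"
    using i by (simp add: div_greater_zero_iff dvd_imp_le)
  then have "md i \<noteq> 1" by (simp add: md_def)
  then obtain q where q: "prime q" "q dvd md i"
    using prime_factor_nat by blast
  have qG: "q > G"
    using dvd_md_imp[OF i q(2)] prime_gt_1_nat[OF q(1)] by (cases "q \<le> G") auto
  have "md i dvd (s + Suc w) choose Suc w"
    unfolding binomial_eq_prod_md using i by (intro dvd_prodI) auto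
  then have qM: "q dvd (s + Suc w) choose Suc w" using q(2) dvd_trans by blast
  define z where "z v = A v mod q" for v
  have z: "z v \<le> u" if "v < V" for v
  proof -
    have "q dvd A v choose Suc u" using qM dvd(2)[OF that] by (rule dvd_trans)
    then have "int q dvd (\<Prod>j<Suc u. int (A v) - int j)"
      unfolding prod_diff_eq_fact_binomial by (simp del: fact_Suc)
    then obtain j where j: "j < Suc u" "int q dvd int (A v) - int j"
      using q(1) by (subst (asm) prime_dvd_prod_iff) auto
    then have "[A v = j] (mod q)"
      by (metis cong_iff_dvd_diff cong_int_iff)
    then have "z v = j mod q" by (simp add: z_def cong_def)
    then show ?thesis using j by (metis less_Suc_eq_le mod_less_eq_dividend order_trans)
  qed
  have "[P (- int s - 1) (\<lambda>v. int (A v)) = P (int k) (\<lambda>v. int (z v))] (mod int q)"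
  proof (rule cong)
    have "[- int s - 1 = int i - 1] (mod int q)"
      using cong_uminus_s[OF i] q(2) by (meson cong_dvd_modulus int_dvd_int_iff)
    then show "[- int s - 1 = int k] (mod int q)" by (simp add: i_def)
    show "[int (A v) = int (z v)] (mod int q)" for v
      by (simp add: z_def cong_def zmod_int)
  qed
  moreover have "int q dvd P (- int s - 1) (\<lambda>v. int (A v))"
    using qM dvd(1) by (meson dvd_trans int_dvd_int_iff)
  ultimately have "int q dvd P (int k) (\<lambda>v. int (z v))"
    by (simp add: cong_dvd_iff)
  moreover have "\<bar>P (int k) (\<lambda>v. int (z v))\<bar> < int q"
    using bound[of z, OF z] qG by (auto simp: G_def)
  ultimately have "P (int k) (\<lambda>v. int (z v)) = 0"
    using dvd_imp_le_int[of "P (int k) (\<lambda>v. int (z v))" "int q"] by linarith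
  then show ?thesis by blast
qed

text \<open>The Chinese remainder theorem merges the witnesses for all \<open>k\<close> into one
  vector \<open>A\<close>. Each modulus divides the required numbers, and so does the product, since
  the moduli are coprime.\<close>

lemma bounded_quantifier_complete:
  fixes P :: "int \<Rightarrow> (nat \<Rightarrow> int) \<Rightarrow> int"
  assumes cong: "\<And>k k' z z' m. [k = k'] (mod m) \<Longrightarrow> (\<And>v. v < V \<Longrightarrow> [z v = z' v] (mod m)) \<Longrightarrow> [P k z = P k' z'] (mod m)"
    and z: "\<And>k v. k \<le> w \<Longrightarrow> v < V \<Longrightarrow> z k v \<le> u" "\<And>k. k \<le> w \<Longrightarrow> P (int k) (\<lambda>v. int (z k v)) = 0"
    and s: "s = (fact (b + w + u + 2))\<^sup>2"
  shows "\<exists>A. int ((s + Suc w) choose Suc w) dvd P (- int s - 1) (\<lambda>v. int (A v)) \<and>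
      (\<forall>v<V. (s + Suc w) choose Suc w dvd A v choose Suc u)"
proof -
  define G where "G = b + w + u + 2"
  interpret moduli G "Suc w" s
    by unfold_locales (auto simp: G_def s)
  have "\<exists>x. \<forall>i\<in>{1..Suc w}. [x = z (i - 1) v] (mod md i)" for v
    by (rule chinese_remainder_nat) (auto intro: coprime_md)
  then obtain A where A: "\<And>v i. i \<in> {1..Suc w} \<Longrightarrow> [A v = z (i - 1) v] (mod md i)"
    by metis
  have "int (md i) dvd P (- int s - 1) (\<lambda>v. int (A v))" if i: "i \<in> {1..Suc w}" for i
  proof -
    have "[P (- int s - 1) (\<lambda>v. int (A v)) = P (int (i - 1)) (\<lambda>v. int (z (i - 1) v))] (mod int (md i))"
      using cong_uminus_s[OF i] i A[OF i] by (intro cong) (auto simp: cong_int_iff of_nat_diff)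
    then show ?thesis
      using z(2)[of "i - 1"] i by (auto simp: cong_0_iff)
  qed
  then have "(\<Prod>i\<in>{1..Suc w}. int (md i)) dvd P (- int s - 1) (\<lambda>v. int (A v))"
    by (intro prod_dvd_if_coprime) (auto intro: coprime_md)
  moreover have "(s + Suc w) choose Suc w dvd A v choose Suc u" if v: "v < V" for v
  proof -
    have "int (md i) dvd int (A v choose Suc u)" if i: "i \<in> {1..Suc w}" for i
    proof -
      have "[int (A v) = int (z (i - 1) v)] (mod int (md i))"
        using A[OF i] by (simp add: cong_int_iff)
      then have "int (md i) dvd int (A v) - int (z (i - 1) v)"
        by (simp add: cong_iff_dvd_diff)
      moreover have "(int (A v) - int (z (i - 1) v)) dvd (\<Prod>j<Suc u. int (A v) - int j)"
      proof (rule dvd_prodI)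
        have "i - 1 \<le> w" using i by auto
        from z(1)[OF this v] show "z (i - 1) v \<in> {..<Suc u}" by simp
      qed simp
      ultimately have "int (md i) dvd fact (Suc u) * int (A v choose Suc u)"
        unfolding prod_diff_eq_fact_binomial by (rule dvd_trans)
      \<comment> \<open>\<open>G\<close> exceeds \<open>u\<close>, so the factorial in front of the
        binomial coefficient can be cancelled.\<close>
      moreover have "coprime (int (md i)) (fact (Suc u))"
      proof -
        have "fact (Suc u) dvd (fact G :: nat)" by (rule fact_dvd) (simp add: G_def)
        then have "coprime (md i) (fact (Suc u))"
          using coprime_md_fact[OF i] by (meson coprime_divisors dvd_refl)
        then show ?thesis by (metis coprime_int_iff of_nat_fact)
      qed
      ultimately show ?thesis by (simp add: coprime_dvd_mult_right_iff)
    qed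
    then have "(\<Prod>i\<in>{1..Suc w}. int (md i)) dvd int (A v choose Suc u)"
      by (intro prod_dvd_if_coprime) (auto intro: coprime_md)
    then show ?thesis unfolding binomial_eq_prod_md by (simp only: of_nat_prod[symmetric] int_dvd_int_iff)
  qed
  ultimately show ?thesis
    unfolding binomial_eq_prod_md of_nat_prod by blast
qed

lemma dioph_peval_eq_0: "dioph b (\<lambda>r. peval (\<lambda>i. int (r i)) q = 0)"
  by (rule diophI[where ps = "[]" and p = "map_pexp Inl q"]) auto

text \<open>The integer quotient is represented by a difference of two natural numbers.\<close>

lemma dioph_dvd_peval:
  assumes "dioph_fun b f"
  shows "dioph b (\<lambda>r. int (f r) dvd peval (\<lambda>i. int (r i)) q)"
proof -
  let ?q = "Add (map_pexp (\<lambda>i. Suc (Suc (Suc i))) q) (Mul (Var 2) (pdiff (Var 1) (Var 0)))"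
  have "dioph b (\<lambda>r. peval (\<lambda>i. int (r i)) ?q = 0)"
    by (rule dioph_peval_eq_0)
  then have "dioph b (\<lambda>r. \<exists>m. m = f r \<and> (\<exists>c d. peval (\<lambda>i. int (r i)) q + int m * (int c - int d) = 0))"
    using assms unfolding dioph_fun_def by (intro dioph_ex dioph_conj) (auto simp: numeral_2_eq_2)
  moreover have "(\<exists>c d. x + m * (int c - int d) = 0) \<longleftrightarrow> m dvd x" for x m
  proof
    assume "\<exists>c d. x + m * (int c - int d) = 0"
    then obtain c d where "x + m * (int c - int d) = 0" by blast
    then have "x = m * (int d - int c)" by (simp add: algebra_simps)
    then show "m dvd x" by simp
  next
    assume "m dvd x"
    then obtain y where "x = m * y" by (elim dvdE)
    then have "x + m * (int (nat (- y)) - int (nat y)) = 0"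
      by (cases "y \<ge> 0") auto
    then show "\<exists>c d. x + m * (int c - int d) = 0" by blast
  qed
  ultimately show ?thesis by simp
qed

text \<open>Besides \<open>w\<close>, the existential form guesses a common bound \<open>u\<close>
  of the witnesses for all \<open>k\<close>, the number \<open>s\<close> determined by these bounds,
  and one vector \<open>A\<close> in place of all the witnesses.\<close>

theorem davis_imp_dioph:
  assumes "davis R"
  shows "dioph True R"
proof -
  obtain Q where Q: "dioph False (\<lambda>r. Q (r 0) (r 1) (\<lambda>i. r (Suc (Suc i))))"
    and R: "\<And>r. R r \<longleftrightarrow> (\<exists>w. \<forall>k\<le>w. Q w k r)"
    using assms unfolding davis_def by blast
  obtain p :: "(nat + nat) pexp" where p: "\<And>r. Q (r 0) (r 1) (\<lambda>i. r (Suc (Suc i))) \<longleftrightarrow>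
      (\<exists>z. peval (\<lambda>v. int (case_sum r z v)) p = 0)"
    by (rule dioph_FalseE[OF Q], rule that, assumption)
  define P where "P w r k z = peval (\<lambda>v. case v of Inl i \<Rightarrow> (case i of 0 \<Rightarrow> int w | Suc j \<Rightarrow> (case j of 0 \<Rightarrow> k | Suc l \<Rightarrow> int (r l))) | Inr j \<Rightarrow> z j) p"
    for w and k :: int and r :: "nat \<Rightarrow> nat" and z :: "nat \<Rightarrow> int"
  \<comment> \<open>Bounds \<open>P\<close> for all \<open>k\<close> up to \<open>w\<close> and all
    witnesses up to \<open>u\<close>: putting \<open>w\<close> for \<open>k\<close> makes it
    independent of \<open>k\<close>, and \<open>pabs\<close> keeps it polynomial.\<close>
  define b where "b w u r = nat (peval (\<lambda>v. case v of Inl i \<Rightarrow> (case i of 0 \<Rightarrow> int w | Suc j \<Rightarrow> (case j of 0 \<Rightarrow> int w | Suc l \<Rightarrow> int (r l))) | Inr j \<Rightarrow> int u) (pabs p))"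
    for w u :: nat and r :: "nat \<Rightarrow> nat"
  have QP: "Q w k r \<longleftrightarrow> (\<exists>z. P w r (int k) (\<lambda>v. int (z v)) = 0)" for w k r
  proof -
    let ?r = "\<lambda>i. case i of 0 \<Rightarrow> w | Suc j \<Rightarrow> (case j of 0 \<Rightarrow> k | Suc l \<Rightarrow> r l)"
    have "peval (\<lambda>v. int (case_sum ?r z v)) p = P w r (int k) (\<lambda>v. int (z v))" for z
      unfolding P_def by (rule peval_cong) (auto split: sum.splits nat.splits)
    then show ?thesis using p[of ?r] by simp
  qed
  have "finite (Inr -` set_pexp p)" by (intro finite_vimageI) auto
  then obtain V where V: "\<And>v. Inr v \<in> set_pexp p \<Longrightarrow> v < V"
    unfolding finite_nat_set_iff_bounded by auto
  have cong: "[P w r k z = P w r k' z'] (mod m)"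
    if "[k = k'] (mod m)" "\<And>v. v < V \<Longrightarrow> [z v = z' v] (mod m)" for w r k k' z z' m
    unfolding P_def using that V by (intro peval_cong_mod) (auto split: sum.splits nat.splits)
  have b: "int (b w u r) = peval (\<lambda>v. case v of Inl i \<Rightarrow> (case i of 0 \<Rightarrow> int w | Suc j \<Rightarrow> (case j of 0 \<Rightarrow> int w | Suc l \<Rightarrow> int (r l))) | Inr j \<Rightarrow> int u) (pabs p)"
    for w u r
  proof -
    have "0 \<le> \<bar>peval (\<lambda>v. 0 :: int) p\<bar>" by simp
    also have "\<dots> \<le> peval (\<lambda>v. case v of Inl i \<Rightarrow> (case i of 0 \<Rightarrow> int w | Suc j \<Rightarrow> (case j of 0 \<Rightarrow> int w | Suc l \<Rightarrow> int (r l))) | Inr j \<Rightarrow> int u) (pabs p)"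
      by (rule abs_peval_le) (auto split: sum.splits nat.splits)
    finally show ?thesis by (simp add: b_def)
  qed
  have bound: "\<bar>P w r (int k) (\<lambda>v. int (z v))\<bar> \<le> int (b w u r)"
    if "k \<le> w" "\<And>v. v < V \<Longrightarrow> z v \<le> u" for w r k z u
    unfolding P_def b using that V by (intro abs_peval_le) (auto split: sum.splits nat.splits)
  define T where "T s u w A r \<longleftrightarrow> s = (fact (b w u r + w + u + 2))\<^sup>2 \<and>
    int ((s + Suc w) choose Suc w) dvd P w r (- int s - 1) (\<lambda>v. int (A v)) \<and>
    (\<forall>v<V. (s + Suc w) choose Suc w dvd A v choose Suc u)" for s u w A r
  have R_iff: "R r \<longleftrightarrow> (\<exists>A w u s. T s u w A r)" for r
  proof
    assume "R r"
    then obtain w where "\<forall>k\<le>w. \<exists>z. P w r (int k) (\<lambda>v. int (z v)) = 0"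
      unfolding R QP by blast
    then obtain z where z: "\<And>k. k \<le> w \<Longrightarrow> P w r (int k) (\<lambda>v. int (z k v)) = 0" by metis
    \<comment> \<open>Any common bound would do; the sum avoids a maximum over a possibly empty
      set.\<close>
    define u where "u = (\<Sum>(k, v)\<in>{..w} \<times> {..<V}. z k v)"
    have "z k v \<le> u" if "k \<le> w" "v < V" for k v
      unfolding u_def using that member_le_sum[of "(k, v)" "{..w} \<times> {..<V}" "\<lambda>(k, v). z k v"] by auto
    from bounded_quantifier_complete[where P = "P w r" and V = V and b = "b w u r", OF cong this z refl]
    show "\<exists>A w u s. T s u w A r"
      unfolding T_def by blast
  next
    assume "\<exists>A w u s. T s u w A r"
    then obtain A w u s where T: "T s u w A r" by blast
    have "\<exists>z. P w r (int k) (\<lambda>v. int (z v)) = 0" if "k \<le> w" for k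
      by (rule bounded_quantifier_sound[where P = "P w r" and V = V and u = u and b = "b w u r" and w = w and s = s and A = A])
        (use T cong bound that in \<open>auto simp: T_def\<close>)
    then show "R r" unfolding R QP by blast
  qed
  \<comment> \<open>Positions 0, 1, 2 hold \<open>s\<close>, \<open>u\<close>, \<open>w\<close>;
    above them the environment and the vector \<open>A\<close> alternate, as
    \<open>dioph_ex_vec\<close> expects.\<close>
  have "dioph True (\<lambda>r. T (r 0) (r 1) (r 2) (\<lambda>i. r (2 * i + 4)) (\<lambda>i. r (2 * i + 3)))"
    unfolding T_def
  proof (intro dioph_conj)
    let ?q = "psubst (\<lambda>v. case v of Inl i \<Rightarrow> (case i of 0 \<Rightarrow> Var 2 | Suc j \<Rightarrow> (case j of 0 \<Rightarrow> Var 2 | Suc l \<Rightarrow> Var (2 * l + 3)))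
      | Inr j \<Rightarrow> Var 1) (pabs p)"
    have "poly_fun (\<lambda>r. b (r 2) (r 1) (\<lambda>i. r (2 * i + 3)))"
      unfolding poly_fun_def b peval_psubst
      by (intro exI[of _ ?q] allI, unfold peval_psubst, intro peval_cong) (auto split: sum.splits nat.splits)
    then show "dioph True (\<lambda>r. r 0 = (fact (b (r 2) (r 1) (\<lambda>i. r (2 * i + 3)) + r 2 + r 1 + 2))\<^sup>2)"
      unfolding power2_eq_square
      by (intro dioph_fun_eq dioph_fun_mult dioph_fun_fact dioph_fun_poly) auto
    let ?p = "psubst (\<lambda>v. case v of Inl i \<Rightarrow> (case i of 0 \<Rightarrow> Var 2 | Suc j \<Rightarrow>
      (case j of 0 \<Rightarrow> pdiff (Const (-1)) (Var 0) | Suc l \<Rightarrow> Var (2 * l + 3))) | Inr j \<Rightarrow> Var (2 * j + 4)) p"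
    have "P (r 2) (\<lambda>i. r (2 * i + 3)) (- int (r 0) - 1) (\<lambda>v. int (r (2 * v + 4))) = peval (\<lambda>i. int (r i)) ?p" for r
      unfolding P_def peval_psubst by (intro peval_cong) (auto split: sum.splits nat.splits)
    then show "dioph True (\<lambda>r. int ((r 0 + Suc (r 2)) choose Suc (r 2)) dvd
        P (r 2) (\<lambda>i. r (2 * i + 3)) (- int (r 0) - 1) (\<lambda>v. int (r (2 * v + 4))))"
      by (simp only:) (intro dioph_dvd_peval dioph_fun_binomial dioph_fun_poly poly_fun_add poly_fun_Suc poly_fun_var)
    show "dioph True (\<lambda>r. \<forall>v<V. (r 0 + Suc (r 2)) choose Suc (r 2) dvd r (2 * v + 4) choose Suc (r 1))"
      by (intro dioph_all_less dioph_fun_dvd dioph_fun_binomial dioph_fun_poly poly_fun_add poly_fun_Suc poly_fun_var)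
  qed
  then show ?thesis unfolding R_iff
    by (intro dioph_ex_vec dioph_ex) (simp add: numeral_eq_Suc)
qed

section \<open>Encoding by orbits\<close>

text \<open>The parameter becomes unknown 0, so that all numbers are treated alike. Since only
  \<open>r 0\<close> matters, the environment may be taken constant and all free variables be
  identified.\<close>

lemma dioph_normal_form:
  assumes "dioph True (\<lambda>r. R (r 0))"
  obtains p :: "nat pexp" and ps where
    "\<And>a. R a \<longleftrightarrow> (\<exists>v. v 0 = a \<and> (\<forall>(x, y) \<in> set ps. v y = 2 ^ v x) \<and> peval (\<lambda>i. int (v i)) p = 0)"
proof -
  obtain p :: "(nat + nat) pexp" and ps where
    R: "\<And>r. R (r 0) \<longleftrightarrow> (\<exists>w. (\<forall>(x, y) \<in> set ps. w y = 2 ^ w x) \<and> peval (\<lambda>v. int (case_sum r w v)) p = 0)"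
    by (rule diophE[OF assms], rule that, assumption)
  let ?p = "map_pexp (case_sum (\<lambda>i. 0) Suc) p" and ?ps = "map (map_prod Suc Suc) ps"
  have p: "peval (\<lambda>i. int (v i)) ?p = peval (\<lambda>u. int (case_sum (\<lambda>i. v 0) (\<lambda>i. v (Suc i)) u)) p" for v
    unfolding peval_map_pexp by (rule peval_cong) (auto split: sum.splits)
  have ps: "(\<forall>(x, y) \<in> set ?ps. v y = 2 ^ v x) \<longleftrightarrow> (\<forall>(x, y) \<in> set ps. v (Suc y) = 2 ^ v (Suc x))"
    for v :: "nat \<Rightarrow> nat"
    by (auto simp: case_prod_beta)
  show thesis
  proof (rule that[of ?ps ?p])
    fix a
    have "R a \<longleftrightarrow> (\<exists>w. (\<forall>(x, y) \<in> set ps. w y = 2 ^ w x) \<and> peval (\<lambda>v. int (case_sum (\<lambda>i. a) w v)) p = 0)"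
      using R[of "\<lambda>i. a"] .
    also have "\<dots> \<longleftrightarrow> (\<exists>v. v 0 = a \<and> (\<forall>(x, y) \<in> set ?ps. v y = 2 ^ v x) \<and> peval (\<lambda>i. int (v i)) ?p = 0)"
      (is "(\<exists>w. ?A w) \<longleftrightarrow> (\<exists>v. ?B v)")
    proof
      assume "\<exists>w. ?A w"
      then obtain w where w: "?A w" ..
      show "\<exists>v. ?B v"
        unfolding p ps by (rule exI[of _ "\<lambda>i. case i of 0 \<Rightarrow> a | Suc j \<Rightarrow> w j"], unfold nat.case) (use w in simp)
    next
      assume "\<exists>v. ?B v"
      then obtain v where v: "?B v" ..
      show "\<exists>w. ?A w"
        by (rule exI[of _ "\<lambda>i. v (Suc i)"]) (use v p ps in auto)
    qed
    finally show "R a \<longleftrightarrow> (\<exists>v. v 0 = a \<and> (\<forall>(x, y) \<in> set ?ps. v y = 2 ^ v x) \<and> peval (\<lambda>i. int (v i)) ?p = 0)" .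
  qed
qed

section \<open>Polynomial expressions as lists of terms\<close>

definition monom_val :: "real vec \<Rightarrow> nat list \<Rightarrow> real" where
  "monom_val x e = (\<Prod>i<dim_vec x. x $ i ^ (e ! i))"

lemma eval_mpoly_altdef: "eval_mpoly P x = (\<Sum>(c, e)\<leftarrow>P. of_int c * monom_val x e)"
  by (simp add: eval_mpoly_def monom_val_def)

lemma eval_mpoly_append: "eval_mpoly (P @ Q) x = eval_mpoly P x + eval_mpoly Q x"
  by (simp add: eval_mpoly_def)

lemma monom_val_replicate_0: "monom_val x (replicate (dim_vec x) 0) = 1"
  by (simp add: monom_val_def)

lemma monom_val_unit:
  assumes "i < dim_vec x"
  shows "monom_val x ((replicate (dim_vec x) 0)[i := 1]) = x $ i"
proof -
  have "monom_val x ((replicate (dim_vec x) 0)[i := 1]) = (\<Prod>j<dim_vec x. if i = j then x $ i else 1)"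
    unfolding monom_val_def by (rule prod.cong) (auto simp: nth_list_update)
  then show ?thesis using assms by simp
qed

lemma monom_val_add:
  assumes "length e = dim_vec x" "length e' = dim_vec x"
  shows "monom_val x (map2 (+) e e') = monom_val x e * monom_val x e'"
  using assms by (simp add: monom_val_def power_add prod.distrib)

primrec to_mpoly :: "nat \<Rightarrow> nat pexp \<Rightarrow> int_mpoly" where
  "to_mpoly d (Var i) = [(1, (replicate d 0)[i := 1])]"
| "to_mpoly d (Const c) = [(c, replicate d 0)]"
| "to_mpoly d (Add p q) = to_mpoly d p @ to_mpoly d q"
| "to_mpoly d (Mul p q) = map (\<lambda>((c, e), (c', e')). (c * c', map2 (+) e e'))
     (List.product (to_mpoly d p) (to_mpoly d q))"

lemma mpoly_in_to_mpoly: "mpoly_in d (to_mpoly d p)"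
  by (induction p) (fastforce simp: mpoly_in_def)+

lemma sum_list_product:
  fixes f g :: "'b \<Rightarrow> real"
  shows "(\<Sum>(x, y)\<leftarrow>List.product xs ys. f x * g y) = (\<Sum>x\<leftarrow>xs. f x) * (\<Sum>y\<leftarrow>ys. g y)"
  by (induction xs) (auto simp: sum_list_const_mult distrib_right comp_def)

lemma eval_to_mpoly:
  assumes "set_pexp p \<subseteq> {..<d}" "dim_vec x = d"
  shows "eval_mpoly (to_mpoly d p) x = peval (\<lambda>i. x $ i) p"
  using assms
proof (induction p)
  case (Mul p q)
  let ?f = "\<lambda>(c, e). real_of_int c * monom_val x e"
  have len: "length (snd t) = dim_vec x" if "t \<in> set (to_mpoly d r)" for t r
    using mpoly_in_to_mpoly[of d r] that Mul.prems(2) by (auto simp: mpoly_in_def)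
  have "eval_mpoly (to_mpoly d (Mul p q)) x = (\<Sum>(s, t)\<leftarrow>List.product (to_mpoly d p) (to_mpoly d q). ?f s * ?f t)"
    unfolding eval_mpoly_altdef to_mpoly.simps map_map
    by (intro arg_cong[of _ _ sum_list] map_cong refl) (auto simp: monom_val_add dest!: len)
  also have "\<dots> = eval_mpoly (to_mpoly d p) x * eval_mpoly (to_mpoly d q) x"
    unfolding eval_mpoly_altdef by (rule sum_list_product)
  finally show ?case using Mul by simp
qed (auto simp: eval_mpoly_append, auto simp: eval_mpoly_altdef monom_val_unit[unfolded One_nat_def] monom_val_replicate_0)

text \<open>Expansion in the two variables marked by \<open>Inr\<close>: \<open>False\<close> will
  be the time and \<open>True\<close> its power of two. The coefficients remain expressions in the
  other variables, because they will define coordinates of the start vector.\<close>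

lemma bivariate_terms:
  fixes q :: "('v + bool) pexp"
  shows "\<exists>ts. (\<forall>e x y :: real. peval (case_sum e (\<lambda>b. if b then y else x)) q =
      (\<Sum>(a, b, c)\<leftarrow>ts. peval e c * x ^ a * y ^ b)) \<and> (\<forall>(a, b, c)\<in>set ts. set_pexp c \<subseteq> Inl -` set_pexp q)"
proof (induction q)
  case (Var v)
  show ?case
  proof (cases v)
    case (Inl u)
    then show ?thesis by (intro exI[of _ "[(0, 0, Var u)]"]) simp
  next
    case (Inr b)
    then show ?thesis
      by (intro exI[of _ "[(if b then 0 else 1, if b then 1 else 0, Const 1)]"]) simp
  qed
next
  case (Const c)
  show ?case by (intro exI[of _ "[(0, 0, Const c)]"]) simp
next
  case (Add q r)
  then obtain ts us where
    "\<And>e x y :: real. peval (case_sum e (\<lambda>b. if b then y else x)) q = (\<Sum>(a, b, c)\<leftarrow>ts. peval e c * x ^ a * y ^ b)"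
    "\<And>e x y :: real. peval (case_sum e (\<lambda>b. if b then y else x)) r = (\<Sum>(a, b, c)\<leftarrow>us. peval e c * x ^ a * y ^ b)"
    "\<forall>(a, b, c)\<in>set ts. set_pexp c \<subseteq> Inl -` set_pexp q" "\<forall>(a, b, c)\<in>set us. set_pexp c \<subseteq> Inl -` set_pexp r"
    by blast
  then show ?case by (intro exI[of _ "ts @ us"]) (simp, fast)
next
  case (Mul q r)
  then obtain ts us where ts:
    "\<And>e x y :: real. peval (case_sum e (\<lambda>b. if b then y else x)) q = (\<Sum>(a, b, c)\<leftarrow>ts. peval e c * x ^ a * y ^ b)"
    "\<And>e x y :: real. peval (case_sum e (\<lambda>b. if b then y else x)) r = (\<Sum>(a, b, c)\<leftarrow>us. peval e c * x ^ a * y ^ b)"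
    "\<forall>(a, b, c)\<in>set ts. set_pexp c \<subseteq> Inl -` set_pexp q" "\<forall>(a, b, c)\<in>set us. set_pexp c \<subseteq> Inl -` set_pexp r"
    by blast
  let ?ts = "map (\<lambda>((a, b, c), (a', b', c')). (a + a', b + b', Mul c c')) (List.product ts us)"
  have "peval (case_sum e (\<lambda>b. if b then y else x)) (Mul q r) = (\<Sum>(a, b, c)\<leftarrow>?ts. peval e c * x ^ a * y ^ b)"
    for e and x y :: real
  proof -
    let ?f = "\<lambda>(a, b, c). peval e c * x ^ a * y ^ b"
    have "(\<Sum>(a, b, c)\<leftarrow>?ts. peval e c * x ^ a * y ^ b) = (\<Sum>(t, u)\<leftarrow>List.product ts us. ?f t * ?f u)"
      unfolding map_map by (intro arg_cong[of _ _ sum_list] map_cong refl) (auto simp: power_add)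
    also have "\<dots> = (\<Sum>t\<leftarrow>ts. ?f t) * (\<Sum>u\<leftarrow>us. ?f u)" by (rule sum_list_product)
    finally show ?thesis using ts(1,2) by simp
  qed
  moreover have "\<forall>(a, b, c)\<in>set ?ts. set_pexp c \<subseteq> Inl -` set_pexp (Mul q r)"
    using ts(3,4) by fastforce
  ultimately show ?case by blast
qed

text \<open>Terms with equal exponents are collected, so that each exponent pair in a finite square
  gets one coordinate.\<close>

lemma bivariate_coeffs:
  fixes q :: "('v + bool) pexp"
  obtains D cf where
    "\<And>e x y :: real. peval (case_sum e (\<lambda>b. if b then y else x)) q = (\<Sum>a\<le>D. \<Sum>b\<le>D. peval e (cf a b) * x ^ a * y ^ b)"
    "\<And>a b. set_pexp (cf a b) \<subseteq> Inl -` set_pexp q"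
proof -
  obtain ts where ts:
    "\<And>e x y :: real. peval (case_sum e (\<lambda>b. if b then y else x)) q = (\<Sum>(a, b, c)\<leftarrow>ts. peval e c * x ^ a * y ^ b)"
    "\<And>a b c. (a, b, c) \<in> set ts \<Longrightarrow> set_pexp c \<subseteq> Inl -` set_pexp q"
    using bivariate_terms[of q] by blast
  obtain D where D: "\<And>a b c. (a, b, c) \<in> set ts \<Longrightarrow> a \<le> D \<and> b \<le> D"
  proof -
    have "finite (fst ` set ts \<union> (fst \<circ> snd) ` set ts)" by simp
    then obtain D where "\<forall>n\<in>fst ` set ts \<union> (fst \<circ> snd) ` set ts. n \<le> D"
      unfolding finite_nat_set_iff_bounded_le by blast
    then show thesis by (intro that[of D]) force
  qed
  define cf where "cf us a b = psum (map (\<lambda>(a', b', c). c) (filter (\<lambda>(a', b', c). a' = a \<and> b' = b) us))"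
    for us :: "(nat \<times> nat \<times> 'v pexp) list" and a b
  have "(\<Sum>(a, b, c)\<leftarrow>us. peval e c * x ^ a * y ^ b) = (\<Sum>a\<le>D. \<Sum>b\<le>D. peval e (cf us a b) * x ^ a * y ^ b)"
    if "\<And>a b c. (a, b, c) \<in> set us \<Longrightarrow> a \<le> D \<and> b \<le> D" for us e and x y :: real
    using that
  proof (induction us)
    case Nil
    then show ?case by (simp add: cf_def)
  next
    case (Cons u us)
    obtain a b c where u: "u = (a, b, c)" by (cases u)
    have "a \<le> D" "b \<le> D" using Cons.prems[of a b c] u by auto
    have "peval e (cf (u # us) a' b') = (if a = a' then if b = b' then peval e c else 0 else 0) + peval e (cf us a' b')" for a' b'
      by (simp add: cf_def u psum_def)
    moreover have "(\<Sum>b'\<le>D. (if b = b' then peval e c else 0) * x ^ a * y ^ b') = peval e c * x ^ a * y ^ b"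
    proof -
      have "(\<Sum>b'\<le>D. (if b = b' then peval e c else 0) * x ^ a * y ^ b') =
        (\<Sum>b'\<le>D. if b = b' then peval e c * x ^ a * y ^ b else 0)" by (intro sum.cong) auto
      then show ?thesis using \<open>b \<le> D\<close> by simp
    qed
    ultimately have "(\<Sum>a\<le>D. \<Sum>b\<le>D. peval e (cf (u # us) a b) * x ^ a * y ^ b) =
      (\<Sum>a'\<le>D. if a = a' then peval e c * x ^ a * y ^ b else 0) + (\<Sum>a\<le>D. \<Sum>b\<le>D. peval e (cf us a b) * x ^ a * y ^ b)"
      unfolding sum.distrib[symmetric]
      by (intro sum.cong refl) (auto simp: distrib_right sum.distrib)
    also have "\<dots> = peval e c * x ^ a * y ^ b + (\<Sum>a\<le>D. \<Sum>b\<le>D. peval e (cf us a b) * x ^ a * y ^ b)"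
      using \<open>a \<le> D\<close> by simp
    finally show ?case using Cons u by auto
  qed
  from this[of ts] D have eq: "(\<Sum>(a, b, c)\<leftarrow>ts. peval e c * x ^ a * y ^ b) =
    (\<Sum>a\<le>D. \<Sum>b\<le>D. peval e (cf ts a b) * x ^ a * y ^ b)" for e and x y :: real by blast
  have "set_pexp (cf ts a b) \<subseteq> Inl -` set_pexp q" for a b
    using ts(2) by (fastforce simp: cf_def)
  then show thesis
    using eq ts(1) by (intro that[of "cf ts" D]) simp_all
qed

text \<open>A hit at time \<open>t\<close> selects an index \<open>i\<close> with
  \<open>x i = t\<close>, and this choice is injective. Hence there are at most \<open>n\<close>
  hits, and \<open>n\<close> of them use up every index.\<close>

lemma all_hits:
  fixes x y :: "nat \<Rightarrow> real" and n :: nat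
  defines "H \<equiv> {t :: nat. t \<ge> 1 \<and> (\<exists>i<n. real t = x i \<and> 2 ^ t = y i)}"
  assumes "infinite H \<or> n \<le> card H" "i < n"
  shows "\<exists>t\<ge>1. x i = real t \<and> y i = 2 ^ t"
proof -
  have "\<forall>t\<in>H. \<exists>i<n. real t = x i \<and> 2 ^ t = y i" unfolding H_def by simp
  from bchoice[OF this] obtain f where f: "\<And>t. t \<in> H \<Longrightarrow> f t < n \<and> real t = x (f t) \<and> 2 ^ t = y (f t)"
    by blast
  have inj: "inj_on f H"
  proof (rule inj_onI)
    fix t u assume "t \<in> H" "u \<in> H" "f t = f u"
    then have "real t = real u" using f[of t] f[of u] by simp
    then show "t = u" by simp
  qed
  have sub: "f ` H \<subseteq> {..<n}" using f by blast
  then have "finite (f ` H)" by (rule finite_subset) simp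
  then have "finite H" using inj by (rule finite_imageD)
  then have "n \<le> card (f ` H)" using assms inj by (simp add: card_image)
  then have "f ` H = {..<n}" using sub by (intro card_seteq) auto
  then have "i \<in> f ` H" using assms(3) by simp
  then obtain t where t: "t \<in> H" "f t = i" by blast
  have "t \<ge> 1" using t(1) unfolding H_def by blast
  moreover have "x i = real t" "y i = 2 ^ t" using f[OF t(1)] unfolding t(2) by simp_all
  ultimately show ?thesis by blast
qed

section \<open>Linear algebra over named coordinates\<close>

locale named_indices =
  fixes vs :: "'c list"
  assumes distinct: "distinct vs"
begin

abbreviation dim :: nat where "dim \<equiv> length vs"

definition idx :: "'c \<Rightarrow> nat" where "idx = inv_into {..<dim} ((!) vs)"

lemma inj_nth: "inj_on ((!) vs) {..<dim}"
  using distinct by (simp add: inj_on_nth)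

lemma idx: "c \<in> set vs \<Longrightarrow> idx c < dim \<and> vs ! idx c = c"
  unfolding idx_def using inv_into_into[of c "(!) vs" "{..<dim}"] f_inv_into_f[of c "(!) vs" "{..<dim}"]
  by (auto simp: set_conv_nth)

lemma idx_nth [simp]: "i < dim \<Longrightarrow> idx (vs ! i) = i"
  unfolding idx_def using inj_nth by (intro inv_into_f_f) auto

lemma sum_nth: "(\<Sum>i<dim. f (vs ! i)) = (\<Sum>c\<in>set vs. f c)"
  using distinct by (intro sum.reindex_bij_betw bij_betw_nth) auto

definition to_vec :: "('c \<Rightarrow> 'a) \<Rightarrow> 'a vec" where "to_vec e = vec dim (\<lambda>i. e (vs ! i))"

definition to_mat :: "('c \<Rightarrow> 'c \<Rightarrow> 'a) \<Rightarrow> 'a mat" where "to_mat m = mat dim dim (\<lambda>(i, j). m (vs ! i) (vs ! j))"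

lemma to_vec_carrier [simp]: "to_vec e \<in> carrier_vec dim"
  by (simp add: to_vec_def)

lemma to_mat_carrier [simp]: "to_mat m \<in> carrier_mat dim dim"
  by (simp add: to_mat_def)

lemma dim_to_vec [simp]: "dim_vec (to_vec e) = dim"
  by (simp add: to_vec_def)

lemma to_vec_idx: "c \<in> set vs \<Longrightarrow> to_vec e $ idx c = e c"
  by (simp add: to_vec_def idx)

lemma map_to_vec: "map_vec f (to_vec e) = to_vec (\<lambda>c. f (e c))"
  by (auto simp: to_vec_def)

lemma map_to_mat: "map_mat f (to_mat m) = to_mat (\<lambda>c c'. f (m c c'))"
  by (auto simp: to_mat_def)

lemma carrier_vec_eq_to_vec:
  assumes "x \<in> carrier_vec dim" shows "x = to_vec (\<lambda>c. x $ idx c)"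
  using assms by (intro eq_vecI) (auto simp: to_vec_def)

lemma scalar_prod_to_vec: "to_vec e \<bullet> to_vec f = (\<Sum>c\<in>set vs. e c * f c)"
  unfolding scalar_prod_def sum_nth[symmetric] by (simp add: to_vec_def atLeast0LessThan)

lemma to_mat_mult_vec: "to_mat m *\<^sub>v to_vec f = to_vec (\<lambda>c. \<Sum>c'\<in>set vs. m c c' * f c')"
  unfolding sum_nth[symmetric]
  by (intro eq_vecI) (auto simp: to_mat_def to_vec_def scalar_prod_def atLeast0LessThan intro!: sum.cong)

lemma to_mat_pow_mult_vec:
  fixes m :: "'c \<Rightarrow> 'c \<Rightarrow> real"
  assumes step: "\<And>n c. c \<in> set vs \<Longrightarrow> (\<Sum>c'\<in>set vs. m c c' * s n c') = s (Suc n) c"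
  shows "to_mat m ^\<^sub>m n *\<^sub>v to_vec (s k) = to_vec (s (k + n))"
proof (induction n arbitrary: k)
  case 0
  show ?case by (simp add: to_mat_def)
next
  case (Suc n)
  have "to_mat m *\<^sub>v to_vec (s k) = to_vec (s (Suc k))"
    unfolding to_mat_mult_vec by (intro eq_vecI) (auto simp: to_vec_def step)
  then show ?case using Suc.IH[of "Suc k"]
    by (simp add: assoc_mult_mat_vec[of _ dim dim _ dim])
qed

lemma vec_mult_mat_carrier: "A \<in> carrier_mat dim dim \<Longrightarrow> vec_mult_mat x A \<in> carrier_vec dim"
  by (auto simp: vec_mult_mat_def)

lemma vec_mult_mat_scalar_prod:
  assumes "A \<in> carrier_mat dim dim" "x \<in> carrier_vec dim" "y \<in> carrier_vec dim"
  shows "vec_mult_mat x A \<bullet> y = x \<bullet> (A *\<^sub>v y)"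
proof -
  have "vec_mult_mat x A = transpose_mat A *\<^sub>v x"
    using assms by (intro eq_vecI) (auto simp: vec_mult_mat_def intro: comm_scalar_prod)
  then show ?thesis using transpose_vec_mult_scalar[OF assms(1,3,2)] by simp
qed

text \<open>The matrix power is moved from the row vector to the observing vector: the start vector
  stays fixed as a list of coefficients, while the observer runs through the solution
  \<open>s\<close> of the recurrence.\<close>

lemma vec_mult_mat_pow_scalar_prod:
  fixes m :: "'c \<Rightarrow> 'c \<Rightarrow> real"
  assumes "\<And>n c. c \<in> set vs \<Longrightarrow> (\<Sum>c'\<in>set vs. m c c' * s n c') = s (Suc n) c"
  shows "vec_mult_mat (to_vec e) (to_mat m ^\<^sub>m n) \<bullet> to_vec (s 0) = (\<Sum>c\<in>set vs. e c * s n c)"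
  using to_mat_pow_mult_vec[of m s n 0, OF assms]
  by (simp add: vec_mult_mat_scalar_prod scalar_prod_to_vec)

end

text \<open>
  \<open>X i\<close> and \<open>Y i\<close> hold a number and its power of two, \<open>Sq i\<close> a square root that witnesses
  nonnegativity, \<open>Cf a b\<close> the coefficient of \<open>t ^ a * (2 ^ t) ^ b\<close> in the observed sequence.
  \<open>Clock\<close> keeps the points of the orbit distinct and \<open>Par\<close> is minus the parameter.
\<close>

datatype coord = Par | Clock | X nat | Y nat | Sq nat | Cf nat nat

text \<open>A sum of two real squares vanishes only if both do, so a zero means that the time
  \<open>Inr False\<close> and its power \<open>Inr True\<close> agree with one of the
  pairs.\<close>

definition hit_poly :: "nat \<Rightarrow> (coord + bool) pexp" where
  "hit_poly n = foldr (\<lambda>i. Mul (Add (psq (pdiff (Var (Inr False)) (Var (Inl (X i)))))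
     (psq (pdiff (Var (Inr True)) (Var (Inl (Y i))))))) [0..<n] (Const 1)"

lemma prod_list_upt: "(\<Prod>i\<leftarrow>[0..<n]. f i) = (\<Prod>i<n. f i)"
  by (induction n) (auto simp: mult.commute)

lemma peval_hit_poly:
  "peval (case_sum e (\<lambda>b. if b then y else x)) (hit_poly n) =
    (\<Prod>i<n. (x - e (X i))\<^sup>2 + (y - e (Y i))\<^sup>2)"
proof -
  have "peval (case_sum e (\<lambda>b. if b then y else x)) (foldr (\<lambda>i. Mul (Add (psq (pdiff (Var (Inr False)) (Var (Inl (X i)))))
     (psq (pdiff (Var (Inr True)) (Var (Inl (Y i))))))) is (Const 1)) =
     (\<Prod>i\<leftarrow>is. (x - e (X i))\<^sup>2 + (y - e (Y i))\<^sup>2)" for "is"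
    by (induction "is") auto
  then show ?thesis by (simp add: hit_poly_def prod_list_upt)
qed

lemma set_pexp_hit_poly: "Inl -` set_pexp (hit_poly n) \<subseteq> X ` {..<n} \<union> Y ` {..<n}"
proof -
  have "set_pexp (foldr (\<lambda>i. Mul (Add (psq (pdiff (Var (Inr False)) (Var (Inl (X i)))))
     (psq (pdiff (Var (Inr True)) (Var (Inl (Y i))))))) is (Const 1)) \<subseteq>
     range Inr \<union> Inl ` (X ` set is \<union> Y ` set is)" for "is"
    by (induction "is") auto
  from this[of "[0..<n]"] show ?thesis by (auto simp: hit_poly_def)
qed

definition ppow :: "'v pexp \<Rightarrow> nat \<Rightarrow> 'v pexp" where "ppow p k = (Mul p ^^ k) (Const 1)"

lemma peval_ppow [simp]: "peval e (ppow p k) = peval e p ^ k"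
  by (induction k) (auto simp: ppow_def)

lemma set_pexp_ppow: "set_pexp (ppow p k) \<subseteq> set_pexp p"
  by (induction k) (auto simp: ppow_def)

text \<open>There are \<open>V\<close> unknowns but \<open>Suc V\<close> pairs of \<open>X\<close>
  and \<open>Y\<close>: index 0 is the auxiliary offset and index \<open>Suc i\<close> belongs to
  unknown \<open>i\<close>. \<open>V\<close> is positive because unknown 0 is the parameter.\<close>

locale reach_instance =
  fixes p :: "nat pexp" and ps :: "(nat \<times> nat) list" and V D :: nat and cf :: "nat \<Rightarrow> nat \<Rightarrow> coord pexp"
  assumes p: "set_pexp p \<subseteq> {..<V}" and ps: "set ps \<subseteq> {..<V} \<times> {..<V}" and V: "V > 0"
    and cf: "\<And>e x y :: real. peval (case_sum e (\<lambda>b. if b then y else x)) (hit_poly (Suc V)) =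
      (\<Sum>a\<le>D. \<Sum>b\<le>D. peval e (cf a b) * x ^ a * y ^ b)"
    and set_cf: "\<And>a b. set_pexp (cf a b) \<subseteq> Inl -` set_pexp (hit_poly (Suc V))"
begin

text \<open>\<open>Par\<close> comes first so that the linear term added in
  \<open>param_poly\<close> has its exponent at position 0.\<close>

definition coords :: "coord list" where
  "coords = [Par, Clock] @ map X [0..<Suc V] @ map Y [0..<Suc V] @ map Sq [0..<V] @
     map (\<lambda>(a, b). Cf a b) (List.product [0..<Suc D] [0..<Suc D])"

lemma set_coords: "set coords = {Par, Clock} \<union> X ` {..V} \<union> Y ` {..V} \<union> Sq ` {..<V} \<union> (\<lambda>(a, b). Cf a b) ` ({..D} \<times> {..D})"
  unfolding coords_def by (simp add: atLeast0LessThan lessThan_Suc_atMost del: upt_Suc) blast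

sublocale named_indices coords
proof
  show "distinct coords"
    by (auto simp: coords_def distinct_map distinct_product inj_on_def simp del: upt_Suc)
qed

lemma idx_Par [simp]: "idx Par = 0"
  using idx_nth[of 0] by (simp add: coords_def del: idx_nth)

lemma dim_pos: "0 < length coords"
  by (simp add: coords_def)

text \<open>The differences make the values \<open>X i\<close> distinct for arbitrary values of the variables.\<close>

definition var_exp :: "nat \<Rightarrow> coord pexp" where
  "var_exp i = pdiff (Var (X (Suc i))) (Mul (Const (int i + 2)) (Var (X 0)))"

text \<open>Since \<open>X (Suc x)\<close> exceeds unknown \<open>x\<close> by \<open>x + 2\<close>
  times \<open>X 0\<close>, its power of two is that of the unknown times
  \<open>Y 0 ^ (x + 2)\<close>; hence the form of the power relation.\<close>

definition constraints :: "coord pexp list" where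
  "constraints = [pdiff (Var Clock) (Const 1), Add (Var Par) (var_exp 0), psubst var_exp p] @
     map (\<lambda>i. pdiff (var_exp i) (psq (Var (Sq i)))) [0..<V] @
     map (\<lambda>(x, y). pdiff (Var (Y (Suc x))) (Mul (var_exp y) (ppow (Var (Y 0)) (x + 2)))) ps @
     map (\<lambda>(a, b). pdiff (Var (Cf a b)) (cf a b)) (List.product [0..<Suc D] [0..<Suc D])"

text \<open>Free of the parameter, so that its code can be one of the numbers stored in the
  parameter of the diagonal instance.\<close>

definition base_poly :: int_mpoly where
  "base_poly = to_mpoly dim (map_pexp idx (Add (psq (Var Par)) (psum (map psq constraints))))"

text \<open>Together with the square of \<open>Par\<close> in \<open>base_poly\<close>, the first two terms make up \<open>(Par + a)\<^sup>2\<close>.\<close>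

definition param_poly :: "nat \<Rightarrow> int_mpoly" where
  "param_poly a = (2 * int a, (replicate dim 0)[0 := 1]) # ((int a)\<^sup>2, replicate dim 0) # base_poly"

lemma mpoly_in_param_poly: "mpoly_in dim (param_poly a)"
proof -
  have "mpoly_in dim base_poly" unfolding base_poly_def by (rule mpoly_in_to_mpoly)
  then show ?thesis by (auto simp: param_poly_def mpoly_in_def)
qed

lemma set_constraints: "q \<in> set constraints \<Longrightarrow> set_pexp q \<subseteq> set coords"
proof -
  have v: "set_pexp (var_exp i) \<subseteq> set coords" if "i < V" for i
    using that by (auto simp: var_exp_def set_coords)
  have c: "set_pexp (cf a b) \<subseteq> set coords" for a b
    using set_cf[of a b] set_pexp_hit_poly[of "Suc V"] by (auto simp: set_coords lessThan_Suc_atMost)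
  have y: "set_pexp (ppow (Var (Y 0)) k) \<subseteq> set coords" for k
    using set_pexp_ppow[of "Var (Y 0)" k] by (auto simp: set_coords)
  have s: "set_pexp (psubst var_exp p) \<subseteq> set coords"
    unfolding set_pexp_psubst using p v by blast
  have m: "Par \<in> set coords" "Clock \<in> set coords" "\<And>i. i < V \<Longrightarrow> Sq i \<in> set coords" "\<And>i. i \<le> V \<Longrightarrow> Y i \<in> set coords"
    "\<And>a b. a \<le> D \<Longrightarrow> b \<le> D \<Longrightarrow> Cf a b \<in> set coords"
    by (auto simp: set_coords)
  assume "q \<in> set constraints"
  then consider "q = pdiff (Var Clock) (Const 1)" | "q = Add (Var Par) (var_exp 0)" | "q = psubst var_exp p"
    | i where "i < V" "q = pdiff (var_exp i) (psq (Var (Sq i)))"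
    | x y where "(x, y) \<in> set ps" "q = pdiff (Var (Y (Suc x))) (Mul (var_exp y) (ppow (Var (Y 0)) (x + 2)))"
    | a b where "a \<le> D" "b \<le> D" "q = pdiff (Var (Cf a b)) (cf a b)"
    unfolding constraints_def by (auto simp: less_Suc_eq_le simp del: upt_Suc)
  then show "set_pexp q \<subseteq> set coords"
  proof cases
    case (5 x y)
    then have "x < V" "y < V" using ps by auto
    then show ?thesis using 5 v[of y] y[of "x + 2"] m(4)[of "Suc x"] by simp
  qed (use v[of 0] v c y s m V in auto)
qed

definition feasible :: "nat \<Rightarrow> (coord \<Rightarrow> real) \<Rightarrow> bool" where
  "feasible a e \<longleftrightarrow> e Par = - real a \<and> (\<forall>q\<in>set constraints. peval e q = 0)"

lemma eval_param_poly:
  assumes "x \<in> carrier_vec dim"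
  shows "eval_mpoly (param_poly a) x = 0 \<longleftrightarrow> feasible a (\<lambda>c. x $ idx c)"
proof -
  define e where "e c = x $ idx c" for c
  have dim: "dim_vec x = dim" using assms by simp
  let ?q = "Add (psq (Var Par)) (psum (map psq constraints))"
  have "set_pexp ?q \<subseteq> set coords"
    using set_constraints by (auto simp: set_coords)
  then have "set_pexp (map_pexp idx ?q) \<subseteq> {..<dim}"
    using idx by (auto simp only: pexp.set_map)
  then have "eval_mpoly base_poly x = peval e ?q"
    unfolding base_poly_def by (subst eval_to_mpoly) (use dim in \<open>simp_all add: e_def[abs_def]\<close>)
  moreover have "monom_val x ((replicate dim 0)[0 := 1]) = e Par"
    using monom_val_unit[of 0 x] dim dim_pos by (simp add: e_def)
  moreover have "monom_val x (replicate dim 0) = 1"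
    using monom_val_replicate_0[of x] dim by simp
  ultimately have "eval_mpoly (param_poly a) x = (e Par + real a)\<^sup>2 + (\<Sum>q\<leftarrow>constraints. (peval e q)\<^sup>2)"
    by (simp add: param_poly_def eval_mpoly_altdef power2_sum comp_def)
  also have "\<dots> = 0 \<longleftrightarrow> e Par + real a = 0 \<and> (\<forall>q\<in>set constraints. peval e q = 0)"
  proof -
    have "(\<Sum>q\<leftarrow>qs. (peval e q)\<^sup>2) \<ge> 0 \<and> ((\<Sum>q\<leftarrow>qs. (peval e q)\<^sup>2) = 0 \<longleftrightarrow> (\<forall>q\<in>set qs. peval e q = 0))" for qs
      by (induction qs) (auto simp: add_nonneg_eq_0_iff)
    from this[of constraints] show ?thesis by (auto simp: add_nonneg_eq_0_iff)
  qed
  finally show ?thesis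
    unfolding feasible_def e_def by (auto simp: add_eq_0_iff2)
qed

definition holds :: "nat \<Rightarrow> bool" where
  "holds a \<longleftrightarrow> (\<exists>v. v 0 = a \<and> (\<forall>(x, y) \<in> set ps. v y = 2 ^ v x) \<and> peval (\<lambda>i. int (v i)) p = 0)"

lemma feasible_iff:
  "feasible a e \<longleftrightarrow> e Clock = 1 \<and> e Par = - real a \<and> peval e (var_exp 0) = real a \<and>
    peval (\<lambda>i. peval e (var_exp i)) p = 0 \<and> (\<forall>i<V. peval e (var_exp i) = (e (Sq i))\<^sup>2) \<and>
    (\<forall>(x, y) \<in> set ps. e (Y (Suc x)) = peval e (var_exp y) * e (Y 0) ^ (x + 2)) \<and>
    (\<forall>a\<le>D. \<forall>b\<le>D. e (Cf a b) = peval e (cf a b))"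
  unfolding feasible_def constraints_def
  by (auto simp: ball_Un less_Suc_eq_le simp del: upt_Suc)

text \<open>The hits make each \<open>X i\<close> a natural number and \<open>Y i\<close> its power
  of two; the square roots make the differences nonnegative, so the unknowns are natural numbers
  too.\<close>

lemma holds_if_feasible:
  assumes e: "feasible a e"
    and hits: "\<And>i. i \<le> V \<Longrightarrow> \<exists>t\<ge>1. e (X i) = real t \<and> e (Y i) = 2 ^ t"
  shows "holds a"
proof -
  note e' = e[unfolded feasible_iff]
  obtain t where t: "\<And>i. i \<le> V \<Longrightarrow> e (X i) = real (t i) \<and> e (Y i) = 2 ^ t i"
    using hits by metis
  define v where "v i = t (Suc i) - (i + 2) * t 0" for i
  have ve: "peval e (var_exp i) = real (v i)" and le: "(i + 2) * t 0 \<le> t (Suc i)" if "i < V" for i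
  proof -
    have *: "peval e (var_exp i) = real (t (Suc i)) - real ((i + 2) * t 0)"
      using t[of 0] t[of "Suc i"] that by (simp add: var_exp_def algebra_simps)
    have "peval e (var_exp i) \<ge> 0" using e' that by simp
    then show "(i + 2) * t 0 \<le> t (Suc i)" unfolding * by (simp only: diff_ge_0_iff_ge of_nat_le_iff)
    then show "peval e (var_exp i) = real (v i)" unfolding * v_def by (simp only: of_nat_diff)
  qed
  have "v 0 = a" using e' ve[OF V] by simp
  moreover have "v y = 2 ^ v x" if "(x, y) \<in> set ps" for x y
  proof -
    have xy: "x < V" "y < V" using that ps by auto
    \<comment> \<open>The offset contributes the same factor to both expressions of this power;
      cancelling it leaves the required relation.\<close>
    have "(2::real) ^ t (Suc x) = real (v y) * (2 ^ t 0) ^ (x + 2)"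
      using e' that t[of 0] t[of "Suc x"] ve[of y] xy by fastforce
    moreover have "(2::real) ^ t (Suc x) = 2 ^ v x * (2 ^ t 0) ^ (x + 2)"
      using le[OF xy(1)] by (simp add: v_def mult.commute flip: power_mult power_add)
    ultimately have "real (v y) = 2 ^ v x" by simp
    then show ?thesis by (metis of_nat_eq_iff of_nat_numeral of_nat_power)
  qed
  moreover have "peval (\<lambda>i. int (v i)) p = 0"
  proof -
    have "peval (\<lambda>i. peval e (var_exp i)) p = peval (\<lambda>i. real_of_int (int (v i))) p"
      using ve p by (intro peval_cong) auto
    then show ?thesis using e' by (simp add: peval_of_int del: of_int_of_nat_eq)
  qed
  ultimately show ?thesis unfolding holds_def by blast
qed

lemma feasible_if_holds:
  assumes "holds a"
  obtains e t where "feasible a e" "inj_on t {..V}" "\<And>i. i \<le> V \<Longrightarrow> t i \<ge> (1::nat) \<and> e (X i) = real (t i) \<and> e (Y i) = 2 ^ t i"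
proof -
  obtain v where v: "v 0 = a" "\<And>x y. (x, y) \<in> set ps \<Longrightarrow> v y = 2 ^ v x" "peval (\<lambda>i. int (v i)) p = 0"
    using assms unfolding holds_def by blast
  \<comment> \<open>The offset exceeds every unknown, and it is positive because it is itself a hit
    time.\<close>
  define B where "B = Suc (\<Sum>i<V. v i)"
  have vB: "v i < B" if "i < V" for i
    using that member_le_sum[of i "{..<V}" v] by (simp add: B_def)
  define t where "t i = (case i of 0 \<Rightarrow> B | Suc j \<Rightarrow> v j + (j + 2) * B)" for i
  \<comment> \<open>Two stages, because the \<open>Cf\<close> coordinates are functions of the
    \<open>X\<close> and \<open>Y\<close> coordinates.\<close>
  define e0 where "e0 c = (case c of Par \<Rightarrow> - real a | Clock \<Rightarrow> 1 | X i \<Rightarrow> real (t i) | Y i \<Rightarrow> 2 ^ t i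
    | Sq i \<Rightarrow> sqrt (real (v i)) | Cf a b \<Rightarrow> 0)" for c
  define e where "e c = (case c of Cf a b \<Rightarrow> peval e0 (cf a b) | _ \<Rightarrow> e0 c)" for c
  have e: "e Par = - real a" "e Clock = 1" "\<And>i. e (X i) = real (t i)" "\<And>i. e (Y i) = 2 ^ t i"
    "\<And>i. e (Sq i) = sqrt (real (v i))" "\<And>a b. e (Cf a b) = peval e0 (cf a b)"
    by (simp_all add: e_def e0_def)
  have cf_e: "peval e (cf a b) = peval e0 (cf a b)" for a b
  proof (rule peval_cong)
    fix c assume "c \<in> set_pexp (cf a b)"
    then have "c \<in> X ` {..<Suc V} \<union> Y ` {..<Suc V}"
      using set_cf set_pexp_hit_poly by blast
    then show "e c = e0 c" by (auto simp: e_def)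
  qed
  have ve: "peval e (var_exp i) = real (v i)" for i
    by (simp add: var_exp_def e t_def algebra_simps)
  have "peval (\<lambda>i. peval e (var_exp i)) p = peval (\<lambda>i. real_of_int (int (v i))) p"
    using ve by simp
  also have "\<dots> = 0" unfolding peval_of_int v(3) by simp
  finally have "peval (\<lambda>i. peval e (var_exp i)) p = 0" .
  moreover have "e (Y (Suc x)) = peval e (var_exp y) * e (Y 0) ^ (x + 2)" if "(x, y) \<in> set ps" for x y
    unfolding ve v(2)[OF that] by (simp add: e t_def power_add mult.commute flip: power_mult)
  ultimately have "feasible a e"
    unfolding feasible_iff using v(1) by (auto simp: ve e cf_e)
  moreover have "inj_on t {..V}"
  proof -
    \<comment> \<open>Different positive indices occupy disjoint intervals of length
      \<open>B\<close>.\<close>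
    have range: "B * Suc i \<le> t i \<and> t i < B * Suc (Suc i) " if "0 < i" "i \<le> V" for i
      using that vB[of "i - 1"] by (cases i) (auto simp: t_def algebra_simps)
    have "t i < t j" if "i < j" "j \<le> V" for i j
    proof (cases "i = 0")
      case True
      then have "t i = B" by (simp add: t_def)
      also have "B < B * Suc j" using that by (simp add: B_def)
      also have "\<dots> \<le> t j" using range[of j] that by simp
      finally show ?thesis .
    next
      case False
      have "t i < B * Suc (Suc i)" using False range[of i] that by simp
      also have "\<dots> \<le> B * Suc j" using that by (intro mult_left_mono) auto
      also have "\<dots> \<le> t j" using range[of j] that by simp
      finally show ?thesis .
    qed
    then have "t i \<noteq> t j" if "i \<noteq> j" "i \<le> V" "j \<le> V" for i j
      using that by (metis less_irrefl linorder_neqE_nat)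
    then show ?thesis by (auto intro!: inj_onI)
  qed
  moreover have "t i \<ge> 1 \<and> e (X i) = real (t i) \<and> e (Y i) = 2 ^ t i" for i
    by (auto simp: e t_def B_def split: nat.splits)
  ultimately show thesis by (rule that)
qed

text \<open>The row of \<open>Cf a b\<close> expands \<open>(t + 1) ^ a * (2 ^ (t + 1)) ^ b\<close>
  by the binomial theorem, a recurrence with constant coefficients. The clock doubles, and all other
  coordinates become zero after one step.\<close>

definition coord_step :: "coord \<Rightarrow> coord \<Rightarrow> rat" where
  "coord_step c c' = (case c of Clock \<Rightarrow> (if c' = Clock then 2 else 0)
     | Cf a b \<Rightarrow> (case c' of Cf a' b' \<Rightarrow> if b = b' then 2 ^ b * of_nat (a choose a') else 0 | _ \<Rightarrow> 0)
     | _ \<Rightarrow> 0)"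

definition step_mat :: "rat mat" where "step_mat = to_mat coord_step"

text \<open>The values of \<open>t ^ a * (2 ^ t) ^ b\<close> at \<open>t = 0\<close>, where
  \<open>0 ^ 0 = 1\<close>: the initial value of the recurrence, which after \<open>t\<close> steps
  has become that function of \<open>t\<close>.\<close>

definition normal :: "int vec" where
  "normal = to_vec (\<lambda>c. case c of Cf a b \<Rightarrow> 0 ^ a | _ \<Rightarrow> 0)"

lemma normal_carrier: "normal \<in> carrier_vec dim"
  by (simp add: normal_def)

lemma step_mat_carrier: "step_mat \<in> carrier_mat dim dim"
  by (simp add: step_mat_def)

lemma scalar_prod_normal:
  "vec_mult_mat (to_vec e) (map_mat of_rat step_mat ^\<^sub>m t) \<bullet> map_vec of_int normal =
    (\<Sum>a\<le>D. \<Sum>b\<le>D. e (Cf a b) * real t ^ a * (2 ^ t) ^ b)"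
proof -
  define s :: "nat \<Rightarrow> coord \<Rightarrow> real" where
    "s n c = (case c of Cf a b \<Rightarrow> real n ^ a * (2 ^ n) ^ b | _ \<Rightarrow> 0)" for n c
  have sum_Cf: "(\<Sum>c\<in>set coords. f c) = (\<Sum>a\<le>D. \<Sum>b\<le>D. f (Cf a b))"
    if "\<And>c. (\<And>a b. c \<noteq> Cf a b) \<Longrightarrow> f c = 0" for f :: "coord \<Rightarrow> real"
  proof -
    have "(\<Sum>c\<in>set coords. f c) = (\<Sum>c\<in>(\<lambda>(a, b). Cf a b) ` ({..D} \<times> {..D}). f c)"
      by (rule sum.mono_neutral_right) (auto simp: set_coords intro!: that)
    also have "\<dots> = (\<Sum>(a, b)\<in>{..D} \<times> {..D}. f (Cf a b))"
      by (subst sum.reindex) (auto simp: inj_on_def case_prod_beta)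
    also have "\<dots> = (\<Sum>a\<le>D. \<Sum>b\<le>D. f (Cf a b))"
      by (simp add: sum.cartesian_product)
    finally show ?thesis .
  qed
  have "(\<Sum>c'\<in>set coords. of_rat (coord_step c c') * s n c') = s (Suc n) c" if c: "c \<in> set coords" for n c
  proof (cases "\<exists>a b. c = Cf a b")
    case False
    then have "(\<Sum>c'\<in>set coords. of_rat (coord_step c c') * s n c') = 0"
      by (intro sum.neutral) (auto simp: coord_step_def s_def split: coord.splits)
    moreover have "s (Suc n) c = 0" using False by (auto simp: s_def split: coord.splits)
    ultimately show ?thesis by simp
  next
    case True
    then obtain a b where ab: "c = Cf a b" "a \<le> D" "b \<le> D"
      using c by (auto simp: set_coords)
    have *: "of_rat (coord_step c (Cf a' b')) * s n (Cf a' b') =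
      (if b = b' then 2 ^ b * real (a choose a') * (real n ^ a' * (2 ^ n) ^ b) else 0)" for a' b'
      by (simp add: coord_step_def s_def ab(1) of_rat_mult of_rat_power)
    have "(\<Sum>c'\<in>set coords. of_rat (coord_step c c') * s n c') =
      (\<Sum>a'\<le>D. \<Sum>b'\<le>D. if b = b' then 2 ^ b * real (a choose a') * (real n ^ a' * (2 ^ n) ^ b) else 0)"
      unfolding *[symmetric] by (rule sum_Cf) (auto simp: s_def split: coord.splits)
    also have "\<dots> = (\<Sum>a'\<le>D. (2 ^ Suc n) ^ b * (real (a choose a') * real n ^ a'))"
      using ab(3) by (intro sum.cong) (auto simp: power_mult_distrib)
    also have "\<dots> = (\<Sum>a'\<le>a. (2 ^ Suc n) ^ b * (real (a choose a') * real n ^ a'))"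
      using ab(2) by (intro sum.mono_neutral_right) (auto simp: not_le)
    also have "\<dots> = (2 ^ Suc n) ^ b * (real n + 1) ^ a"
      unfolding binomial_ring by (simp add: sum_distrib_left)
    also have "\<dots> = s (Suc n) c"
      by (simp add: s_def ab(1) add.commute)
    finally show ?thesis .
  qed
  from vec_mult_mat_pow_scalar_prod[of "\<lambda>c c'. of_rat (coord_step c c')" s, OF this]
  have "vec_mult_mat (to_vec e) (map_mat of_rat step_mat ^\<^sub>m t) \<bullet> to_vec (s 0) = (\<Sum>c\<in>set coords. e c * s t c)"
    by (simp add: step_mat_def map_to_mat)
  also have "to_vec (s 0) = map_vec of_int normal"
    unfolding normal_def map_to_vec
    by (rule arg_cong[of _ _ to_vec]) (auto simp: s_def fun_eq_iff split: coord.splits)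
  also have "(\<Sum>c\<in>set coords. e c * s t c) = (\<Sum>a\<le>D. \<Sum>b\<le>D. e (Cf a b) * real t ^ a * (2 ^ t) ^ b)"
    by (subst sum_Cf) (auto simp: s_def mult.assoc split: coord.splits)
  finally show ?thesis .
qed

text \<open>Reachability counts points and not times. The clock coordinate at time \<open>t\<close>
  is \<open>2 ^ t\<close>, which separates the points.\<close>

lemma orbit_inj:
  assumes "e Clock = 1"
  shows "inj (\<lambda>t. vec_mult_mat (to_vec e) (map_mat of_rat step_mat ^\<^sub>m t))"
proof (rule injI)
  fix t u
  assume eq: "vec_mult_mat (to_vec e) (map_mat of_rat step_mat ^\<^sub>m t) = vec_mult_mat (to_vec e) (map_mat of_rat step_mat ^\<^sub>m u)"
  define s :: "nat \<Rightarrow> coord \<Rightarrow> real" where "s n c = (if c = Clock then 2 ^ n else 0)" for n c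
  have "Clock \<in> set coords" by (simp add: set_coords)
  then have step: "(\<Sum>c'\<in>set coords. of_rat (coord_step c c') * s n c') = s (Suc n) c" for n c
    by (simp add: s_def if_distrib[of "\<lambda>x. _ * x"] sum.delta cong: if_cong) (auto simp: coord_step_def split: coord.splits)
  have "vec_mult_mat (to_vec e) (map_mat of_rat step_mat ^\<^sub>m n) \<bullet> to_vec (s 0) = 2 ^ n" for n
    using vec_mult_mat_pow_scalar_prod[of "\<lambda>c c'. of_rat (coord_step c c')" s e n, OF step] \<open>Clock \<in> set coords\<close>
    by (simp add: step_mat_def map_to_mat s_def if_distrib[of "\<lambda>x. _ * x"] sum.delta assms cong: if_cong)
  with eq have "(2::real) ^ t = 2 ^ u" by metis
  then show "t = u" by simp
qed

text \<open>For feasible vectors the points in the hyperplane correspond to hit times. The demanded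
  number equals the number of pairs, so by \<open>all_hits\<close> every pair must be hit.\<close>

theorem multiple_reachable_iff:
  "multiple_reachable (algebraic_set dim (param_poly a)) (hyperplane dim normal 0) step_mat (Suc V) \<longleftrightarrow> holds a"
proof -
  define H where "H e = {t :: nat. t \<ge> 1 \<and> (\<exists>i<Suc V. real t = e (X i) \<and> 2 ^ t = e (Y i))}" for e
  let ?M = "map_mat of_rat step_mat :: real mat"
  have M: "?M ^\<^sub>m t \<in> carrier_mat dim dim" for t
    using step_mat_carrier by simp
  have hits: "orbit (to_vec e) step_mat \<inter> hyperplane dim normal 0 = (\<lambda>t. vec_mult_mat (to_vec e) (?M ^\<^sub>m t)) ` H e"
    if "feasible a e" for e
  proof -
    have "vec_mult_mat (to_vec e) (?M ^\<^sub>m t) \<in> hyperplane dim normal 0 \<longleftrightarrow> (\<exists>i<Suc V. real t = e (X i) \<and> 2 ^ t = e (Y i))" for t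
    proof -
      have "vec_mult_mat (to_vec e) (?M ^\<^sub>m t) \<in> carrier_vec dim"
        using M by (rule vec_mult_mat_carrier)
      then have "vec_mult_mat (to_vec e) (?M ^\<^sub>m t) \<in> hyperplane dim normal 0 \<longleftrightarrow>
         vec_mult_mat (to_vec e) (?M ^\<^sub>m t) \<bullet> map_vec of_int normal = 0"
        unfolding hyperplane_def using normal_carrier by (simp add: comm_scalar_prod[of _ dim])
      also have "\<dots> \<longleftrightarrow> (\<Sum>a\<le>D. \<Sum>b\<le>D. peval e (cf a b) * real t ^ a * (2 ^ t) ^ b) = 0"
        unfolding scalar_prod_normal using that by (simp add: feasible_iff)
      also have "\<dots> \<longleftrightarrow> (\<Prod>i<Suc V. (real t - e (X i))\<^sup>2 + (2 ^ t - e (Y i))\<^sup>2) = 0"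
        unfolding cf[symmetric] peval_hit_poly ..
      also have "\<dots> \<longleftrightarrow> (\<exists>i<Suc V. real t = e (X i) \<and> 2 ^ t = e (Y i))"
        by (subst prod_zero_iff) (auto simp: sum_power2_eq_zero_iff)
      finally show ?thesis .
    qed
    then show ?thesis unfolding orbit_def H_def by blast
  qed
  have iff: "infinite (orbit (to_vec e) step_mat \<inter> hyperplane dim normal 0) \<or>
      Suc V \<le> card (orbit (to_vec e) step_mat \<inter> hyperplane dim normal 0) \<longleftrightarrow> infinite (H e) \<or> Suc V \<le> card (H e)"
    if "feasible a e" for e
  proof -
    have "inj_on (\<lambda>t. vec_mult_mat (to_vec e) (?M ^\<^sub>m t)) (H e)"
      using orbit_inj[of e] that inj_on_subset by (auto simp: feasible_iff)
    then show ?thesis unfolding hits[OF that] by (simp add: finite_image_iff card_image)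
  qed
  show ?thesis
  proof
    assume "multiple_reachable (algebraic_set dim (param_poly a)) (hyperplane dim normal 0) step_mat (Suc V)"
    then obtain x where x: "x \<in> carrier_vec dim" "eval_mpoly (param_poly a) x = 0"
      and inf: "infinite (orbit x step_mat \<inter> hyperplane dim normal 0) \<or> Suc V \<le> card (orbit x step_mat \<inter> hyperplane dim normal 0)"
      unfolding multiple_reachable_def algebraic_set_def by blast
    define e where "e c = x $ idx c" for c
    have xe: "x = to_vec e" unfolding e_def by (rule carrier_vec_eq_to_vec[OF x(1)])
    have e: "feasible a e" using x eval_param_poly unfolding e_def by blast
    have "infinite (H e) \<or> Suc V \<le> card (H e)"
      using inf iff[OF e] unfolding xe by blast
    then show "holds a"
      using all_hits[of "Suc V" "\<lambda>i. e (X i)" "\<lambda>i. e (Y i)"]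
      by (intro holds_if_feasible[OF e]) (auto simp: H_def)
  next
    assume "holds a"
    obtain e t where e: "feasible a e" and t: "inj_on t {..V}"
      "\<And>i. i \<le> V \<Longrightarrow> t i \<ge> (1::nat) \<and> e (X i) = real (t i) \<and> e (Y i) = 2 ^ t i"
      by (rule feasible_if_holds[OF \<open>holds a\<close>], rule that, assumption+)
    have "t ` {..V} \<subseteq> H e" using t(2) by (fastforce simp: H_def less_Suc_eq_le)
    then have "infinite (H e) \<or> Suc V \<le> card (H e)"
      using card_mono[of "H e" "t ` {..V}"] card_image[OF t(1)] by auto
    moreover have "to_vec e \<in> algebraic_set dim (param_poly a)"
    proof -
      have "feasible a (\<lambda>c. to_vec e $ idx c) \<longleftrightarrow> feasible a e"
      proof -
        have "peval (\<lambda>c. to_vec e $ idx c) q = peval e q" if "q \<in> set constraints" for q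
          using set_constraints[OF that] by (intro peval_cong to_vec_idx) blast
        moreover have "to_vec e $ idx Par = e Par" by (rule to_vec_idx) (simp add: set_coords)
        ultimately show ?thesis unfolding feasible_def by simp
      qed
      then show ?thesis using e eval_param_poly[of "to_vec e" a] by (simp add: algebraic_set_def)
    qed
    ultimately show "multiple_reachable (algebraic_set dim (param_poly a)) (hyperplane dim normal 0) step_mat (Suc V)"
      using iff[OF e] unfolding multiple_reachable_def by blast
  qed
qed

end

section \<open>Undecidability\<close>

lemma computes_Comp1:
  "computes g xs a \<Longrightarrow> computes f [a] y \<Longrightarrow> computes (Comp f [g]) xs y"
  by (rule computes.Comp[where ys = "[a]"]) auto

lemma computes_Comp2:
  "computes g xs a \<Longrightarrow> computes h xs b \<Longrightarrow> computes f [a, b] y \<Longrightarrow> computes (Comp f [g, h]) xs y"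
  by (rule computes.Comp[where ys = "[a, b]"]) auto

lemma computes_Proj': "i < length xs \<Longrightarrow> xs ! i = y \<Longrightarrow> computes (Proj i) xs y"
  using computes.Proj by blast

definition rf_suc :: "recf \<Rightarrow> recf" where "rf_suc f = Comp Succ [f]"

lemma computes_rf_suc: "computes f xs a \<Longrightarrow> computes (rf_suc f) xs (Suc a)"
  unfolding rf_suc_def by (rule computes_Comp1) (auto intro: computes.Succ)

definition rf_add :: "recf \<Rightarrow> recf \<Rightarrow> recf" where
  "rf_add f g = Comp (PrimRec (Proj 0) (rf_suc (Proj 1))) [f, g]"

lemma computes_rf_add:
  assumes "computes f xs a" "computes g xs b"
  shows "computes (rf_add f g) xs (a + b)"
proof -
  have "computes (PrimRec (Proj 0) (rf_suc (Proj 1))) [a, b] (a + b)"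
  proof (induction a)
    case 0
    show ?case by (rule computes.PrimRec_0) (simp add: computes_Proj')
  next
    case (Suc a)
    show ?case
      by (rule computes.PrimRec_Suc[OF Suc.IH], subst add_Suc, rule computes_rf_suc) (simp add: computes_Proj')
  qed
  with assms show ?thesis unfolding rf_add_def by (rule computes_Comp2)
qed

definition rf_mult :: "recf \<Rightarrow> recf \<Rightarrow> recf" where
  "rf_mult f g = Comp (PrimRec Zero (rf_add (Proj 2) (Proj 1))) [f, g]"

lemma computes_rf_mult:
  assumes "computes f xs a" "computes g xs b"
  shows "computes (rf_mult f g) xs (a * b)"
proof -
  have "computes (PrimRec Zero (rf_add (Proj 2) (Proj 1))) [a, b] (a * b)"
  proof (induction a)
    case 0
    show ?case by (rule computes.PrimRec_0) (simp add: computes.Zero)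
  next
    case (Suc a)
    show ?case
      by (rule computes.PrimRec_Suc[OF Suc.IH], subst mult_Suc, rule computes_rf_add) (simp_all add: computes_Proj')
  qed
  with assms show ?thesis unfolding rf_mult_def by (rule computes_Comp2)
qed

text \<open>The inner recursion computes the triangular number of the pairing function.\<close>

definition rf_pair :: "recf \<Rightarrow> recf \<Rightarrow> recf" where
  "rf_pair f g = rf_add (Comp (PrimRec Zero (rf_add (Proj 1) (rf_suc (Proj 0)))) [rf_add f g]) f"

lemma computes_rf_pair:
  assumes "computes f xs a" "computes g xs b"
  shows "computes (rf_pair f g) xs (prod_encode (a, b))"
proof -
  have "computes (PrimRec Zero (rf_add (Proj 1) (rf_suc (Proj 0)))) [n] (triangle n)" for n
  proof (induction n)
    case 0
    show ?case by (rule computes.PrimRec_0) (simp add: computes.Zero)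
  next
    case (Suc n)
    show ?case
      by (rule computes.PrimRec_Suc[OF Suc.IH], subst triangle_Suc, intro computes_rf_add computes_rf_suc)
        (simp_all add: computes_Proj')
  qed
  with assms show ?thesis unfolding rf_pair_def prod_encode_def prod.case
    by (intro computes_rf_add computes_Comp1[OF computes_rf_add])
qed

text \<open>Only the two coefficients that depend on the parameter are calculated:
  \<open>4 * a\<close> and \<open>2 * a^2\<close> encode the integers \<open>2 * a\<close> and
  \<open>a^2\<close>. All other components are passed in already encoded, and the successor of a
  pair is a list cell.\<close>

definition rf_input :: recf where
  "rf_input =
    (let a = Proj 0;
       t = rf_pair (rf_add (rf_add a a) (rf_add a a)) (Proj 3);
       u = rf_pair (rf_mult a (rf_add a a)) (Proj 2);
       P = rf_suc (rf_pair t (rf_suc (rf_pair u (Proj 4))))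
     in rf_suc (rf_pair (Proj 1) (rf_suc (rf_pair P (Proj 5)))))"

lemma int_encode_int: "int_encode (int n) = 2 * n"
  by (simp add: int_encode_def sum_encode_def)

lemma computes_rf_input:
  "computes rf_input [a, d, list_encode e0, list_encode e1, encode_mpoly P,
      list_encode [encode_int_vec c, int_encode b, encode_rat_mat M, m]]
    (encode_input d ((2 * int a, e1) # ((int a)\<^sup>2, e0) # P) c b M m)"
proof -
  have "4 * a = int_encode (2 * int a)" "a * (a + a) = int_encode ((int a)\<^sup>2)"
    using int_encode_int[of "2 * a"] int_encode_int[of "a\<^sup>2"] by (simp_all add: power2_eq_square)
  then have eq: "encode_input d ((2 * int a, e1) # ((int a)\<^sup>2, e0) # P) c b M m =
    Suc (prod_encode (d, Suc (prod_encode (Suc (prod_encode (prod_encode ((a + a) + (a + a), list_encode e1),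
      Suc (prod_encode (prod_encode (a * (a + a), list_encode e0), encode_mpoly P)))),
      list_encode [encode_int_vec c, int_encode b, encode_rat_mat M, m]))))"
    by (simp add: encode_input_def encode_mpoly_def)
  show ?thesis
    unfolding eq rf_input_def Let_def
    by (intro computes_rf_suc computes_rf_pair computes_rf_add computes_rf_mult)
      (simp_all add: computes_Proj')
qed

theorem theorem2:
  shows "\<not> (\<exists>alg. \<forall>(d::nat) (P::int_mpoly) (a::int vec) (b::int) (M::rat mat) (m::nat).
      d \<ge> 1 \<longrightarrow> mpoly_in d P \<longrightarrow> a \<in> carrier_vec d \<longrightarrow> M \<in> carrier_mat d d \<longrightarrow> m \<ge> 1 \<longrightarrow>
      computes alg [encode_input d P a b M m]
        (if multiple_reachable (algebraic_set d P) (hyperplane d a b) M m then 1 else 0))"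
proof
  assume "\<exists>alg. \<forall>(d::nat) (P::int_mpoly) (a::int vec) (b::int) (M::rat mat) (m::nat).
      d \<ge> 1 \<longrightarrow> mpoly_in d P \<longrightarrow> a \<in> carrier_vec d \<longrightarrow> M \<in> carrier_mat d d \<longrightarrow> m \<ge> 1 \<longrightarrow>
      computes alg [encode_input d P a b M m]
        (if multiple_reachable (algebraic_set d P) (hyperplane d a b) M m then 1 else 0)"
  then obtain alg where alg: "\<And>d P a b M m. d \<ge> 1 \<Longrightarrow> mpoly_in d P \<Longrightarrow> a \<in> carrier_vec d \<Longrightarrow>
      M \<in> carrier_mat d d \<Longrightarrow> m \<ge> 1 \<Longrightarrow> computes alg [encode_input d P a b M m]
        (if multiple_reachable (algebraic_set d P) (hyperplane d a b) M m then 1 else 0)"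
    by blast
  define g where "g = Comp alg [rf_input]"
  define code where "code d e0 e1 q s = prod_encode (d, prod_encode (e0, prod_encode (e1, prod_encode (q, s))))"
    for d e0 e1 q s
  \<comment> \<open>\<open>R\<close> has to be fixed before the instance exists, as the instance is
    built from its normal form. The data of the instance are therefore read off the parameter;
    \<open>R\<close> says that \<open>alg\<close> answers 0 on the input assembled from
    them.\<close>
  define R where "R a \<longleftrightarrow> (\<exists>d e0 e1 q s. a = code d e0 e1 q s \<and> computes g [a, d, e0, e1, q, s] 0)" for a
  \<comment> \<open>The parameter ends up at position 5, behind five bound variables of which the
    last is at 0; hence the reversed order.\<close>
  have "davis (\<lambda>r. computes g (map (\<lambda>i. (case Suc i of 0 \<Rightarrow> 0 | Suc j \<Rightarrow> r (5 - j))) [0..<6]) 0)"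
    using davis_subst[OF davis_computes[of g 6], of "\<lambda>i r. case i of 0 \<Rightarrow> 0 | Suc j \<Rightarrow> r (5 - j)"] by simp
  then have "davis (\<lambda>r. computes g [r 5, r 4, r 3, r 2, r 1, r 0] 0)"
    by (simp add: upt_rec)
  then have "davis (\<lambda>r. R (r 0))"
    unfolding R_def code_def
    by (intro davis_ex davis_conj davis_dioph[OF dioph_fun_eq] dioph_fun_prod_encode dioph_fun_poly poly_fun_var)
      (simp add: numeral_eq_Suc)
  then have "dioph True (\<lambda>r. R (r 0))" by (rule davis_imp_dioph)
  then obtain p :: "nat pexp" and ps where
    R: "\<And>a. R a \<longleftrightarrow> (\<exists>v. v 0 = a \<and> (\<forall>(x, y) \<in> set ps. v y = 2 ^ v x) \<and> peval (\<lambda>i. int (v i)) p = 0)"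
    by (rule dioph_normal_form) (rule that)
  have "finite (set_pexp p \<union> fst ` set ps \<union> snd ` set ps)" by simp
  then obtain V where V: "\<forall>i\<in>set_pexp p \<union> fst ` set ps \<union> snd ` set ps. i < V"
    unfolding finite_nat_set_iff_bounded by blast
  obtain D cf where cf:
    "\<And>e x y :: real. peval (case_sum e (\<lambda>b. if b then y else x)) (hit_poly (Suc (Suc V))) =
      (\<Sum>a\<le>D. \<Sum>b\<le>D. peval e (cf a b) * x ^ a * y ^ b)"
    "\<And>a b. set_pexp (cf a b) \<subseteq> Inl -` set_pexp (hit_poly (Suc (Suc V)))"
    by (rule bivariate_coeffs[of "hit_poly (Suc (Suc V))"], rule that)
  have p: "set_pexp p \<subseteq> {..<Suc V}" using V by (auto intro: less_SucI)
  have "x < Suc V \<and> y < Suc V" if "(x, y) \<in> set ps" for x y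
    using V imageI[OF that, of fst] imageI[OF that, of snd] by (auto intro: less_SucI)
  then have ps: "set ps \<subseteq> {..<Suc V} \<times> {..<Suc V}" by auto
  \<comment> \<open>With \<open>Suc V\<close> unknowns, unknown 0 exists even if no variable
    occurs.\<close>
  interpret reach_instance p ps "Suc V" D cf
    by (rule reach_instance.intro[OF p ps zero_less_Suc cf])
  let ?e0 = "replicate dim 0" and ?e1 = "(replicate dim 0)[0 := 1]"
  let ?s = "list_encode [encode_int_vec normal, int_encode 0, encode_rat_mat step_mat, Suc (Suc V)]"
  \<comment> \<open>The parameter that describes its own instance.\<close>
  define a where "a = code dim (list_encode ?e0) (list_encode ?e1) (encode_mpoly base_poly) ?s"
  have "computes alg [encode_input dim (param_poly a) normal 0 step_mat (Suc (Suc V))] (if holds a then 1 else 0)"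
    using alg[of dim "param_poly a" normal step_mat "Suc (Suc V)" 0] dim_pos mpoly_in_param_poly[of a]
      normal_carrier step_mat_carrier by (simp add: multiple_reachable_iff Suc_le_eq)
  then have "computes g [a, dim, list_encode ?e0, list_encode ?e1, encode_mpoly base_poly, ?s] (if holds a then 1 else 0)"
    unfolding g_def param_poly_def by (intro computes_Comp1[OF computes_rf_input])
  \<comment> \<open>Outputs are unique, so the answer 0 is given exactly if \<open>holds a\<close>
    fails, whereas \<open>R a\<close> equates that answer with \<open>holds a\<close>.\<close>
  then have "computes g [a, dim, list_encode ?e0, list_encode ?e1, encode_mpoly base_poly, ?s] 0 \<longleftrightarrow> \<not> holds a"
    using computes_deterministic by fastforce
  moreover have "R a \<longleftrightarrow> computes g [a, dim, list_encode ?e0, list_encode ?e1, encode_mpoly base_poly, ?s] 0"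
    unfolding R_def by (auto simp: a_def code_def simp del: list_encode.simps)
  moreover have "R a \<longleftrightarrow> holds a"
    unfolding R holds_def ..
  ultimately show False by blast
qed

end
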